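(* There exists an infinitely generated discrete subgroup $\Gamma<\mathrm{Isom}(\mathbb{H}^{2})$ such that the Hausdorff dimension of its nonconical limit set is zero: $\dim \Lambda_{nc}(\Gamma)=0$.
   Context: For a discrete subgroup $\Gamma<\mathrm{Isom}(\mathbb{H}^n)$, the limit set $\Lambda(\Gamma)\subset S^{n-1}=\partial_\infty\mathbb{H}^n$ is the accumulation set of a $\Gamma$-orbit. A limit point $\xi\in\Lambda(\Gamma)$ is nonconical if for some (equivalently every) $x\in\mathbb{H}^n$ the projection of the geodesic ray from $x$ to $\xi$ to the quotient $\mathbb{H}^n/\Gamma$ is a proper map (eventually leaves every compact set); $\Lambda_{nc}(\Gamma)$ denotes the set of nonconical limit points. Hausdorff dimension is taken with respect to the standard (angular/spherical) metric on the ideal boundary circle. *)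

theory Defs
  imports "HOL-Analysis.Analysis"
begin

text \<open>Poincare disk model of the hyperbolic plane H^2: the open unit disk in the complex plane.\<close>

definition hdisk :: "complex set" where
  "hdisk = {z. cmod z < 1}"

definition hdist :: "complex \<Rightarrow> complex \<Rightarrow> real" where
  "hdist z w = arcosh (1 + 2 * (cmod (z - w))^2 / ((1 - (cmod z)^2) * (1 - (cmod w)^2)))"

text \<open>Isometries of H^2: distance-preserving bijections of the disk (normalised to be the
  identity outside the disk, so that composition and inverse are the group operations).\<close>
definition hisom :: "(complex \<Rightarrow> complex) \<Rightarrow> bool" where
  "hisom g \<longleftrightarrow> bij_betw g hdisk hdisk
     \<and> (\<forall>z\<in>hdisk. \<forall>w\<in>hdisk. hdist (g z) (g w) = hdist z w)
     \<and> (\<forall>z. z \<notin> hdisk \<longrightarrow> g z = z)"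

definition isom_subgroup :: "(complex \<Rightarrow> complex) set \<Rightarrow> bool" where
  "isom_subgroup G \<longleftrightarrow> (\<forall>g\<in>G. hisom g) \<and> id \<in> G
     \<and> (\<forall>g\<in>G. \<forall>h\<in>G. g \<circ> h \<in> G) \<and> (\<forall>g\<in>G. inv g \<in> G)"

definition gen_isom_subgroup :: "(complex \<Rightarrow> complex) set \<Rightarrow> (complex \<Rightarrow> complex) set" where
  "gen_isom_subgroup S = \<Inter> {H. isom_subgroup H \<and> S \<subseteq> H}"

definition finitely_generated :: "(complex \<Rightarrow> complex) set \<Rightarrow> bool" where
  "finitely_generated G \<longleftrightarrow> (\<exists>S. finite S \<and> S \<subseteq> G \<and> gen_isom_subgroup S = G)"

text \<open>Discreteness in the compact-open topology: some basic neighbourhood of the identity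
  (isometries moving every point of the closed hyperbolic R-ball about 0 by less than e)
  contains no element of G other than the identity.\<close>
definition discrete_isom_subgroup :: "(complex \<Rightarrow> complex) set \<Rightarrow> bool" where
  "discrete_isom_subgroup G \<longleftrightarrow> isom_subgroup G \<and>
     (\<exists>R>0. \<exists>e>0. \<forall>g\<in>G.
        (\<forall>x\<in>hdisk. hdist x 0 \<le> R \<longrightarrow> hdist (g x) x < e) \<longrightarrow> g = id)"

definition limit_set :: "(complex \<Rightarrow> complex) set \<Rightarrow> complex set" where
  "limit_set G = {\<xi>. cmod \<xi> = 1 \<and> \<xi> islimpt ((\<lambda>g. g 0) ` G)}"

text \<open>Unit-speed geodesic ray from 0 towards the ideal point xi.\<close>
definition geo_ray :: "complex \<Rightarrow> real \<Rightarrow> complex" where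
  "geo_ray \<xi> t = complex_of_real (tanh (t / 2)) * \<xi>"

text \<open>Nonconical limit points: the projection of the ray to H^2/G eventually leaves every
  compact set, i.e. eventually leaves the image of every closed hyperbolic ball about 0.\<close>
definition nonconical_limit_set :: "(complex \<Rightarrow> complex) set \<Rightarrow> complex set" where
  "nonconical_limit_set G = {\<xi>\<in>limit_set G.
     \<forall>R. \<exists>T. \<forall>t\<ge>T. \<forall>g\<in>G. hdist (g (geo_ray \<xi> t)) 0 > R}"

definition ang_dist :: "complex \<Rightarrow> complex \<Rightarrow> real" where
  "ang_dist z w = arccos (Re (z * cnj w))"

definition ang_diam :: "complex set \<Rightarrow> real" where
  "ang_diam U = (if U = {} then 0 else (SUP p\<in>U \<times> U. ang_dist (fst p) (snd p)))"

definition hausdorff_pre :: "real \<Rightarrow> real \<Rightarrow> complex set \<Rightarrow> ennreal" where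
  "hausdorff_pre s \<delta> E = (INF U\<in>{U :: nat \<Rightarrow> complex set.
       E \<subseteq> (\<Union>n. U n) \<and> (\<forall>n. U n \<subseteq> sphere 0 1 \<and> ang_diam (U n) \<le> \<delta>)}.
       (\<Sum>n. ennreal (ang_diam (U n) powr s)))"

definition hausdorff_measure :: "real \<Rightarrow> complex set \<Rightarrow> ennreal" where
  "hausdorff_measure s E = (SUP \<delta>\<in>{0<..}. hausdorff_pre s \<delta> E)"

definition hausdorff_dim :: "complex set \<Rightarrow> real" where
  "hausdorff_dim E = Inf {s. s > 0 \<and> hausdorff_measure s E = 0}"

end

theory Submission
  imports Defs
begin

text \<open>The group is generated by the reflections in infinitely many disjoint geodesics, which bound
  tiny half-planes accumulating only at the ideal point \<open>1\<close>; by ping-pong it is the free product of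
  infinitely many groups of order two. A limit point outside the orbit of \<open>1\<close> is coded by the infinite
  sequence \<open>\<nu>\<close> of mirrors crossed by the ray from \<open>0\<close>. Whenever mirror \<open>n\<close> recurs in \<open>\<nu>\<close>, the ray
  returns to a compact set depending only on \<open>n\<close>, so \<open>\<nu>\<close> tends to infinity at a nonconical limit
  point. On the other half-planes the \<open>n\<close>-th reflection contracts by a factor at most \<open>2 ^ (- n\<^sup>2)\<close>,
  and the \<open>s\<close>-th powers of these factors are summable for every \<open>s > 0\<close>. Hence the limit points coded
  by letters \<open>\<ge> N\<close> satisfy, for \<open>N\<close> large, \<open>h \<le> h / 2\<close> for their \<open>s\<close>-dimensional content \<open>h\<close>.\<close>

section \<open>Angular distance\<close>

lemma ang_dist_nonneg_le_pi:
  assumes "cmod z = 1" "cmod w = 1"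
  shows "0 \<le> ang_dist z w" "ang_dist z w \<le> pi"
proof -
  have "\<bar>Re (z * cnj w)\<bar> \<le> 1"
    using abs_Re_le_cmod[of "z * cnj w"] assms by (simp add: norm_mult)
  then show "0 \<le> ang_dist z w" "ang_dist z w \<le> pi"
    by (auto simp: ang_dist_def abs_le_iff intro!: arccos_lbound arccos_ubound)
qed

lemma ang_dist_self: "cmod z = 1 \<Longrightarrow> ang_dist z z = 0"
  by (simp add: ang_dist_def complex_mult_cnj cmod_def)

lemma chord_eq_sin_half_ang_dist:
  assumes "cmod z = 1" "cmod w = 1"
  shows "cmod (z - w) = 2 * sin (ang_dist z w / 2)"
proof -
  have b: "\<bar>Re (z * cnj w)\<bar> \<le> 1"
    using abs_Re_le_cmod[of "z * cnj w"] assms by (simp add: norm_mult)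
  have "(cmod (z - w))\<^sup>2 = (cmod z)\<^sup>2 + (cmod w)\<^sup>2 - 2 * Re (z * cnj w)"
    by (simp only: cmod_power2) (simp add: power2_eq_square algebra_simps)
  also have "\<dots> = 2 - 2 * cos (ang_dist z w)"
    using b assms by (simp add: ang_dist_def cos_arccos_abs)
  also have "\<dots> = (2 * sin (ang_dist z w / 2))\<^sup>2"
    using cos_double_sin[of "ang_dist z w / 2"] by (simp add: power2_eq_square)
  finally have sq: "(cmod (z - w))\<^sup>2 = (2 * sin (ang_dist z w / 2))\<^sup>2" .
  have "0 \<le> sin (ang_dist z w / 2)"
    using ang_dist_nonneg_le_pi[OF assms] by (intro sin_ge_zero) auto
  then show ?thesis
    by (intro power2_eq_imp_eq[OF sq]) simp_all
qed

lemma chord_le_ang_dist: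
  assumes "cmod z = 1" "cmod w = 1"
  shows "cmod (z - w) \<le> ang_dist z w"
  using sin_x_le_x[of "ang_dist z w / 2"] ang_dist_nonneg_le_pi[OF assms]
  by (simp add: chord_eq_sin_half_ang_dist[OF assms])

text \<open>Half the angle, \<open>y\<close>, is at most 2, so the cubic Taylor bound gives
  \<open>sin y \<ge> y - 4 * y / 6 = y / 3\<close>. The constant 3 is generous; the factor 1/16 in
  \<open>reflect_contraction\<close> absorbs it.\<close>

lemma ang_dist_le_chord:
  assumes "cmod z = 1" "cmod w = 1"
  shows "ang_dist z w \<le> 3 * cmod (z - w)"
proof -
  define y where "y = ang_dist z w / 2"
  have y: "0 \<le> y" "y \<le> 2"
    using ang_dist_nonneg_le_pi[OF assms] pi_less_4 by (auto simp: y_def)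
  have "\<bar>sin y - (\<Sum>m<3. sin_coeff m * y ^ m)\<bar> \<le> inverse (fact 3) * \<bar>y\<bar> ^ 3"
    by (rule Maclaurin_sin_bound)
  then have "\<bar>sin y - y\<bar> \<le> y * y\<^sup>2 / 6"
    using y by (simp add: eval_nat_numeral sin_coeff_def)
  moreover have "y * y\<^sup>2 \<le> y * 4"
    using y power_mono[of y 2 2] by (intro mult_left_mono) auto
  ultimately have "y \<le> 3 * sin y"
    by linarith
  then show ?thesis
    by (simp add: chord_eq_sin_half_ang_dist[OF assms] y_def)
qed

lemma ang_dist_le_ang_diam:
  assumes "U \<subseteq> sphere 0 1" "z \<in> U" "w \<in> U"
  shows "ang_dist z w \<le> ang_diam U"
proof -
  have "ang_dist (fst (z, w)) (snd (z, w)) \<le> (SUP p\<in>U \<times> U. ang_dist (fst p) (snd p))"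
    using assms by (intro cSUP_upper bdd_aboveI2[where M = pi]) (auto intro!: ang_dist_nonneg_le_pi)
  then show ?thesis
    using assms by (auto simp: ang_diam_def)
qed

lemma ang_diam_leI:
  assumes "\<And>z w. z \<in> U \<Longrightarrow> w \<in> U \<Longrightarrow> ang_dist z w \<le> b" "0 \<le> b"
  shows "ang_diam U \<le> b"
  using assms by (auto simp: ang_diam_def intro!: cSUP_least)

lemma ang_diam_nonneg:
  assumes "U \<subseteq> sphere 0 1"
  shows "0 \<le> ang_diam U"
proof (cases "U = {}")
  case False
  then obtain z where "z \<in> U" by auto
  with ang_dist_le_ang_diam[OF assms this this] ang_dist_self[of z] assms show ?thesis
    by auto
qed (simp add: ang_diam_def)

section \<open>Hausdorff content\<close>

definition sphere_covers :: "complex set \<Rightarrow> (nat \<Rightarrow> complex set) set" where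
  "sphere_covers E = {U. E \<subseteq> (\<Union>n. U n) \<and> (\<forall>n. U n \<subseteq> sphere 0 1)}"

text \<open>This is \<open>hausdorff_pre\<close> without the bound on diameters, so that the
  estimates for unions and Lipschitz images run with no scale to adjust.\<close>

definition hausdorff_content :: "real \<Rightarrow> complex set \<Rightarrow> ennreal" where
  "hausdorff_content s E = (INF U\<in>sphere_covers E. \<Sum>n. ennreal (ang_diam (U n) powr s))"

lemma hausdorff_content_le:
  assumes "E \<subseteq> (\<Union>n. U n)" "\<And>n. U n \<subseteq> sphere 0 1"
  shows "hausdorff_content s E \<le> (\<Sum>n. ennreal (ang_diam (U n) powr s))"
  using assms by (auto simp: hausdorff_content_def sphere_covers_def intro!: INF_lower)

lemma hausdorff_content_lessE:
  assumes "hausdorff_content s E < b"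
  obtains U where "E \<subseteq> (\<Union>n. U n)" "\<And>n. U n \<subseteq> sphere 0 1"
    "(\<Sum>n. ennreal (ang_diam (U n) powr s)) < b"
  using assms by (auto simp: hausdorff_content_def sphere_covers_def INF_less_iff)

lemma hausdorff_content_mono: "E \<subseteq> F \<Longrightarrow> hausdorff_content s E \<le> hausdorff_content s F"
  unfolding hausdorff_content_def by (rule INF_superset_mono) (auto simp: sphere_covers_def)

text \<open>Padding a one-set cover by empty sets costs nothing because \<open>0 powr s = 0\<close>.
  In particular the content of a subset of the circle is finite.\<close>

lemma hausdorff_content_le_ang_diam:
  assumes "E \<subseteq> sphere 0 1"
  shows "hausdorff_content s E \<le> ennreal (ang_diam E powr s)"
proof -
  define U where "U = (\<lambda>n::nat. if n = 0 then E else {})"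
  have "hausdorff_content s E \<le> (\<Sum>n. ennreal (ang_diam (U n) powr s))"
    by (rule hausdorff_content_le) (use assms in \<open>auto simp: U_def split: if_splits\<close>)
  also have "\<dots> = (\<Sum>n\<in>{0}. ennreal (ang_diam (U n) powr s))"
    by (rule suminf_finite) (auto simp: U_def ang_diam_def)
  finally show ?thesis
    by (simp add: U_def)
qed

lemma hausdorff_content_singleton: "cmod z = 1 \<Longrightarrow> hausdorff_content s {z} = 0"
  using hausdorff_content_le_ang_diam[of "{z}" s] by (simp add: ang_diam_def ang_dist_self)

text \<open>Covers of the \<open>A i\<close> that exceed the infimum by less than
  \<open>e / 2 ^ Suc i\<close> are merged into one sequence along the pairing
  \<open>prod_decode\<close>.\<close>

lemma hausdorff_content_countable_subadditive:
  "hausdorff_content s (\<Union>i::nat. A i) \<le> (\<Sum>i. hausdorff_content s (A i))"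
proof (rule ennreal_le_epsilon)
  fix e :: real
  assume fin: "(\<Sum>i. hausdorff_content s (A i)) < top" and e: "0 < e"
  have "\<exists>U. A i \<subseteq> (\<Union>n. U n) \<and> (\<forall>n. U n \<subseteq> sphere 0 1) \<and>
      (\<Sum>n. ennreal (ang_diam (U n) powr s)) < hausdorff_content s (A i) + ennreal (e * (1/2) ^ Suc i)"
    for i
  proof -
    have "hausdorff_content s (A i) < top"
      using ennreal_suminf_lessD[OF fin] .
    moreover have "0 < ennreal (e * (1/2) ^ Suc i)"
      using e by (simp add: ennreal_zero_less_mult_iff)
    ultimately have "hausdorff_content s (A i) < hausdorff_content s (A i) + ennreal (e * (1/2) ^ Suc i)"
      by (simp add: ennreal_add_left_cancel_less)
    then show ?thesis
      by (elim hausdorff_content_lessE) blast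
  qed
  then obtain U where U: "\<And>i. A i \<subseteq> (\<Union>n. U i n)" "\<And>i n. U i n \<subseteq> sphere 0 1"
    "\<And>i. (\<Sum>n. ennreal (ang_diam (U i n) powr s))
       < hausdorff_content s (A i) + ennreal (e * (1/2) ^ Suc i)"
    by metis
  define V where "V = (\<lambda>k. case_prod U (prod_decode k))"
  have "hausdorff_content s (\<Union>i. A i) \<le> (\<Sum>k. ennreal (ang_diam (V k) powr s))"
  proof (rule hausdorff_content_le)
    show "(\<Union>i. A i) \<subseteq> (\<Union>k. V k)"
    proof
      fix x assume "x \<in> (\<Union>i. A i)"
      then obtain i n where "x \<in> U i n"
        using U(1) by blast
      then have "x \<in> V (prod_encode (i, n))"
        by (simp add: V_def)
      then show "x \<in> (\<Union>k. V k)" by blast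
    qed
    show "V k \<subseteq> sphere 0 1" for k
      using U(2) by (auto simp: V_def split: prod.splits)
  qed
  also have "\<dots> = (\<Sum>k. (\<lambda>p. ennreal (ang_diam (case_prod U p) powr s)) (prod_decode k))"
    by (simp add: V_def)
  also have "\<dots> = (\<Sum>i. \<Sum>n. ennreal (ang_diam (U i n) powr s))"
    by (rule suminf_ennreal_2dimen) simp
  also have "\<dots> \<le> (\<Sum>i. hausdorff_content s (A i) + ennreal (e * (1/2) ^ Suc i))"
    by (intro suminf_le less_imp_le[OF U(3)]) auto
  also have "\<dots> = (\<Sum>i. hausdorff_content s (A i)) + (\<Sum>i. ennreal (e * (1/2) ^ Suc i))"
    by (rule suminf_add[symmetric]) auto
  also have "(\<Sum>i. ennreal (e * (1/2) ^ Suc i)) = ennreal e"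
    using sums_mult[OF power_half_series, of e] e
    by (intro suminf_ennreal_eq) (simp_all only: mult_1_right, auto)
  finally show "hausdorff_content s (\<Union>i. A i) \<le> (\<Sum>i. hausdorff_content s (A i)) + ennreal e" .
qed

lemma hausdorff_content_UN_zero:
  assumes "\<And>i::nat. hausdorff_content s (A i) = 0"
  shows "hausdorff_content s (\<Union>i. A i) = 0"
  using hausdorff_content_countable_subadditive[of s A] by (simp add: assms)

lemma hausdorff_content_Un_zero:
  assumes "hausdorff_content s A = 0" "hausdorff_content s B = 0"
  shows "hausdorff_content s (A \<union> B) = 0"
proof -
  have "A \<union> B = (\<Union>i::nat. if i = 0 then A else B)"
    by (auto split: if_splits)
  then show ?thesis
    using hausdorff_content_UN_zero[of s "\<lambda>i. if i = 0 then A else B"] assms by simp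
qed

text \<open>Each cover of \<open>A\<close> is pushed forward by \<open>f\<close> after intersecting
  with \<open>A\<close>, since \<open>f\<close> is controlled only there.\<close>

lemma hausdorff_content_image_le:
  assumes "A \<subseteq> sphere 0 1" "f ` A \<subseteq> sphere 0 1" "0 < k" "0 \<le> s"
    and lip: "\<And>z w. z \<in> A \<Longrightarrow> w \<in> A \<Longrightarrow> ang_dist (f z) (f w) \<le> k * ang_dist z w"
  shows "hausdorff_content s (f ` A) \<le> ennreal (k powr s) * hausdorff_content s A"
proof -
  let ?c = "ennreal (k powr s)"
  have c: "0 < ?c" "?c < top" "?c \<noteq> 0"
    using \<open>0 < k\<close> by auto
  have "hausdorff_content s (f ` A) \<le> ?c * (\<Sum>n. ennreal (ang_diam (U n) powr s))"
    if "U \<in> sphere_covers A" for U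
  proof -
    have U: "A \<subseteq> (\<Union>n. U n)" "\<And>n. U n \<subseteq> sphere 0 1"
      using that by (auto simp: sphere_covers_def)
    have "ang_diam (f ` (U n \<inter> A)) \<le> k * ang_diam (U n)" for n
    proof (rule ang_diam_leI)
      fix x y assume "x \<in> f ` (U n \<inter> A)" "y \<in> f ` (U n \<inter> A)"
      then obtain z w where zw: "z \<in> U n" "w \<in> U n" "z \<in> A" "w \<in> A" "x = f z" "y = f w"
        by auto
      have "ang_dist x y \<le> k * ang_dist z w"
        using lip zw by simp
      also have "\<dots> \<le> k * ang_diam (U n)"
        using zw U(2) \<open>0 < k\<close> by (intro mult_left_mono ang_dist_le_ang_diam) auto
      finally show "ang_dist x y \<le> k * ang_diam (U n)" .
    qed (use \<open>0 < k\<close> ang_diam_nonneg[OF U(2)] in auto)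
    then have "ang_diam (f ` (U n \<inter> A)) powr s \<le> k powr s * ang_diam (U n) powr s" for n
      using \<open>0 < k\<close> \<open>0 \<le> s\<close> ang_diam_nonneg[OF U(2), of n]
        ang_diam_nonneg[of "f ` (U n \<inter> A)"] assms(2)
      by (subst powr_mult[symmetric]) (auto intro!: powr_mono2)
    then have le: "ennreal (ang_diam (f ` (U n \<inter> A)) powr s) \<le> ?c * ennreal (ang_diam (U n) powr s)" for n
      by (simp add: ennreal_mult[symmetric] ennreal_leI)
    have "hausdorff_content s (f ` A) \<le> (\<Sum>n. ennreal (ang_diam (f ` (U n \<inter> A)) powr s))"
    proof (rule hausdorff_content_le)
      show "f ` A \<subseteq> (\<Union>n. f ` (U n \<inter> A))"
        using U(1) by blast
      show "f ` (U n \<inter> A) \<subseteq> sphere 0 1" for n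
        using assms(2) by blast
    qed
    also have "\<dots> \<le> (\<Sum>n. ?c * ennreal (ang_diam (U n) powr s))"
      by (intro suminf_le le) auto
    finally show ?thesis by simp
  qed
  \<comment> \<open>Dividing by \<open>?c\<close>, which is neither 0 nor top, leaves a lower bound
    for every cover sum, so the infimum can be taken.\<close>
  then have "hausdorff_content s (f ` A) / ?c \<le> hausdorff_content s A"
    unfolding hausdorff_content_def[of s A]
    by (intro INF_greatest divide_le_posI_ennreal[OF c(1)])
  then have "?c * (hausdorff_content s (f ` A) / ?c) \<le> ?c * hausdorff_content s A"
    by (rule mult_left_mono) simp
  also have "?c * (hausdorff_content s (f ` A) / ?c) = hausdorff_content s (f ` A)"
    using c(2,3) by (simp only: ennreal_times_divide mult.commute[of ?c])
      (simp add: ennreal_mult_divide_eq)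
  finally show ?thesis .
qed

text \<open>A cover of total weight below \<open>\<delta> powr s\<close> automatically has all diameters below \<open>\<delta>\<close>, so the
  scale \<open>\<delta>\<close> is irrelevant for null sets.\<close>
lemma hausdorff_measure_zero_if_content_zero:
  assumes "hausdorff_content s E = 0" "0 < s"
  shows "hausdorff_measure s E = 0"
proof -
  have "hausdorff_pre s d E \<le> 0" if d: "0 < d" for d
  proof (rule ennreal_le_epsilon)
    fix e :: real assume e: "0 < e"
    have "hausdorff_content s E < min (ennreal e) (ennreal (d powr s))"
      using assms d e by simp
    then obtain U where U: "E \<subseteq> (\<Union>n. U n)" "\<And>n. U n \<subseteq> sphere 0 1"
        "(\<Sum>n. ennreal (ang_diam (U n) powr s)) < min (ennreal e) (ennreal (d powr s))"
      by (elim hausdorff_content_lessE) blast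
    have "ang_diam (U n) \<le> d" for n
    proof -
      have "ennreal (ang_diam (U n) powr s) < ennreal (d powr s)"
        using ennreal_suminf_lessD[OF U(3), of n] by simp
      then have "ang_diam (U n) powr s < d powr s"
        by (simp add: ennreal_less_iff)
      then show ?thesis
        using powr_mono2[of s d "ang_diam (U n)"] \<open>0 < s\<close> d by linarith
    qed
    then have "hausdorff_pre s d E \<le> (\<Sum>n. ennreal (ang_diam (U n) powr s))"
      unfolding hausdorff_pre_def using U by (intro INF_lower) auto
    also have "\<dots> \<le> ennreal e"
      using U(3) less_imp_le min_less_iff_conj by blast
    finally show "hausdorff_pre s d E \<le> 0 + ennreal e" by simp
  qed
  then have "hausdorff_measure s E \<le> 0"
    unfolding hausdorff_measure_def by (intro SUP_least) auto
  then show ?thesis by simp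
qed

lemma hausdorff_dim_zero_if_content_zero:
  assumes "\<And>s. 0 < s \<Longrightarrow> hausdorff_content s E = 0"
  shows "hausdorff_dim E = 0"
proof -
  have "{s. s > 0 \<and> hausdorff_measure s E = 0} = {0::real<..}"
    using assms by (auto simp: hausdorff_measure_zero_if_content_zero)
  then show ?thesis
    by (simp add: hausdorff_dim_def)
qed

section \<open>Maps conformal for the chordal metric\<close>

text \<open>The value \<open>m z\<close> plays the role of the modulus of the derivative. The two
  identities are those satisfied by every Moebius or anti-Moebius map of the disk. Stating them as a
  relation treats both orientations alike and is stable under composition.\<close>

definition conformal_factor :: "(complex \<Rightarrow> complex) \<Rightarrow> (complex \<Rightarrow> real) \<Rightarrow> bool" where
  "conformal_factor f m \<longleftrightarrow> (\<forall>z\<in>cball 0 1. 0 < m z \<and> 1 - (cmod (f z))\<^sup>2 = m z * (1 - (cmod z)\<^sup>2)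
      \<and> (\<forall>w\<in>cball 0 1. (cmod (f z - f w))\<^sup>2 = m z * m w * (cmod (z - w))\<^sup>2))"

lemma conformal_factorD:
  assumes "conformal_factor f m" "cmod z \<le> 1"
  shows "0 < m z" "1 - (cmod (f z))\<^sup>2 = m z * (1 - (cmod z)\<^sup>2)"
    and "cmod w \<le> 1 \<Longrightarrow> (cmod (f z - f w))\<^sup>2 = m z * m w * (cmod (z - w))\<^sup>2"
  using assms by (auto simp: conformal_factor_def)

lemma cmod_less_1_iff: "cmod z < 1 \<longleftrightarrow> 0 < 1 - (cmod z)\<^sup>2"
  using abs_square_less_1[of "cmod z"] by auto

lemma cmod_le_1_iff: "cmod z \<le> 1 \<longleftrightarrow> 0 \<le> 1 - (cmod z)\<^sup>2"
  using abs_square_le_1[of "cmod z"] by auto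

lemma conformal_factor_cmod_le_1:
  assumes "conformal_factor f m" "cmod z \<le> 1"
  shows "cmod (f z) \<le> 1"
  using conformal_factorD(1,2)[OF assms] assms(2) cmod_le_1_iff[of z] cmod_le_1_iff[of "f z"] by simp

lemma conformal_factor_cmod_less_1:
  assumes "conformal_factor f m" "cmod z < 1"
  shows "cmod (f z) < 1"
  using conformal_factorD(1,2)[OF assms(1), of z] assms(2) cmod_less_1_iff[of z] cmod_less_1_iff[of "f z"]
  by simp

lemma conformal_factor_id: "conformal_factor (\<lambda>z. z) (\<lambda>_. 1)"
  by (simp add: conformal_factor_def)

lemma conformal_factor_compose:
  assumes f: "conformal_factor f m" and g: "conformal_factor g k"
  shows "conformal_factor (\<lambda>z. f (g z)) (\<lambda>z. m (g z) * k z)"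
  unfolding conformal_factor_def
proof (intro ballI conjI)
  fix z :: complex assume "z \<in> cball 0 1"
  then have z: "cmod z \<le> 1" by simp
  note gz = conformal_factor_cmod_le_1[OF g z]
  show "0 < m (g z) * k z"
    using conformal_factorD(1)[OF f gz] conformal_factorD(1)[OF g z] by simp
  show "1 - (cmod (f (g z)))\<^sup>2 = m (g z) * k z * (1 - (cmod z)\<^sup>2)"
    using conformal_factorD(2)[OF f gz] conformal_factorD(2)[OF g z] by simp
  fix w :: complex assume "w \<in> cball 0 1"
  then have w: "cmod w \<le> 1" by simp
  show "(cmod (f (g z) - f (g w)))\<^sup>2 = m (g z) * k z * (m (g w) * k w) * (cmod (z - w))\<^sup>2"
    using conformal_factorD(3)[OF f gz conformal_factor_cmod_le_1[OF g w]]
      conformal_factorD(3)[OF g z w] by simp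
qed

lemma arcosh_mono:
  fixes x y :: real
  assumes "1 \<le> x" "x \<le> y"
  shows "arcosh x \<le> arcosh y"
  using assms by (cases "x = y") (auto intro!: less_imp_le arcosh_real_strict_mono)

text \<open>In the quotient inside \<open>hdist\<close> the factors \<open>m z * m w\<close>
  cancel.\<close>

lemma conformal_factor_hdist:
  assumes f: "conformal_factor f m" and "cmod z < 1" "cmod w < 1"
  shows "hdist (f z) (f w) = hdist z w"
proof -
  have "0 < m z" "0 < m w" and "1 - (cmod (f z))\<^sup>2 = m z * (1 - (cmod z)\<^sup>2)"
    "1 - (cmod (f w))\<^sup>2 = m w * (1 - (cmod w)\<^sup>2)"
    "(cmod (f z - f w))\<^sup>2 = m z * m w * (cmod (z - w))\<^sup>2"
    using assms conformal_factorD[OF f] by auto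
  then show ?thesis
    by (simp add: hdist_def)
qed

text \<open>The square of the left side is \<open>m \<xi> * m 0\<close> times the fourth power of
  \<open>cmod (\<xi> - b)\<close>. The pair \<open>\<xi>, b\<close> determines
  \<open>m \<xi>\<close>, and \<open>m 0 * m b = 1\<close>. So if \<open>f \<xi>\<close> and
  \<open>f 0\<close> are well separated, \<open>b\<close> must be close to
  \<open>\<xi>\<close>.\<close>

lemma conformal_factor_cmod_diff_0:
  fixes b \<xi> :: complex
  assumes f: "conformal_factor f m" and b: "cmod b < 1" "f b = 0" and \<xi>: "cmod \<xi> = 1"
  shows "cmod (f \<xi> - f 0) * cmod (\<xi> - b) = 1 - (cmod b)\<^sup>2"
proof -
  have pos: "0 < m 0" "0 < m b" "0 < 1 - (cmod b)\<^sup>2"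
    using conformal_factorD(1)[OF f, of 0] conformal_factorD(1)[OF f, of b] b cmod_less_1_iff[of b]
    by simp_all
  have "cmod (f \<xi>) = 1"
    using conformal_factorD(2)[OF f, of \<xi>] \<xi> by (simp add: power2_eq_1_iff)
      (metis norm_ge_zero not_one_le_zero neg_0_le_iff_le order_trans)
  then have 1: "m \<xi> * m b * (cmod (\<xi> - b))\<^sup>2 = 1"
    using conformal_factorD(3)[OF f, of \<xi> b] \<xi> b by simp
  have 2: "m b * (1 - (cmod b)\<^sup>2) = 1"
    using conformal_factorD(2)[OF f, of b] b by simp
  have 3: "m 0 = 1 - (cmod (f 0))\<^sup>2"
    using conformal_factorD(2)[OF f, of 0] by simp
  have "(cmod (f 0))\<^sup>2 = m 0 * m b * (cmod b)\<^sup>2"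
    using conformal_factorD(3)[OF f, of 0 b] b by simp
  then have "1 = m 0 * (1 + m b * (cmod b)\<^sup>2)"
    using 3 unfolding distrib_left by linarith
  also have "1 + m b * (cmod b)\<^sup>2 = m b"
    using 2 unfolding right_diff_distrib by linarith
  finally have 4: "m 0 * m b = 1" by simp
  have "(cmod (f \<xi> - f 0) * cmod (\<xi> - b))\<^sup>2 = m \<xi> * m 0 * (cmod (\<xi> - b))\<^sup>2"
    using conformal_factorD(3)[OF f, of \<xi> 0] \<xi> by (simp add: power_mult_distrib)
  \<comment> \<open>Two factors \<open>m b * (1 - (cmod b)^2) = 1\<close> are inserted so that the
    known products \<open>m 0 * m b\<close> and \<open>m \<xi> * m b * (cmod (\<xi> - b))^2\<close>
    can be split off.\<close>
  also have "\<dots> = (m 0 * (m b * (1 - (cmod b)\<^sup>2))) * (m \<xi> * (cmod (\<xi> - b))\<^sup>2) * (m b * (1 - (cmod b)\<^sup>2))"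
    using 2 by simp
  also have "\<dots> = (m 0 * m b) * (m \<xi> * m b * (cmod (\<xi> - b))\<^sup>2) * (1 - (cmod b)\<^sup>2)\<^sup>2"
    by (simp add: power2_eq_square mult_ac)
  also have "\<dots> = (1 - (cmod b)\<^sup>2)\<^sup>2"
    using 1 4 by simp
  finally show ?thesis
    using pos by (simp add: power2_eq_iff_nonneg)
qed

text \<open>Here \<open>hdist (f z) 0 = hdist z b\<close>, and by the previous lemma \<open>b\<close> lies within Euclidean distance
  \<open>(1 - (cmod b)\<^sup>2) / d\<close> of \<open>\<xi>\<close>, hence within a bounded hyperbolic distance of \<open>z = cmod b * \<xi>\<close>.\<close>
lemma conformal_factor_ray_recurrence:
  fixes b \<xi> :: complex
  assumes f: "conformal_factor f m" and b: "cmod b < 1" "f b = 0" and \<xi>: "cmod \<xi> = 1"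
    and d: "0 < d" "d \<le> cmod (f \<xi> - f 0)"
  shows "hdist (f (of_real (cmod b) * \<xi>)) 0 \<le> arcosh (1 + 2 * (1 / d + 1)\<^sup>2)"
proof -
  define q where "q = 1 - (cmod b)\<^sup>2"
  have q: "0 < q"
    using b cmod_less_1_iff[of b] by (simp add: q_def)
  define z where "z = of_real (cmod b) * \<xi>"
  have z: "cmod z = cmod b"
    using \<xi> by (simp add: z_def norm_mult)
  have "d * cmod (\<xi> - b) \<le> q"
    using conformal_factor_cmod_diff_0[OF f b \<xi>] mult_right_mono[OF d(2), of "cmod (\<xi> - b)"]
    by (simp add: q_def)
  then have "cmod (\<xi> - b) \<le> q * (1 / d)"
    using d by (simp add: field_simps)
  moreover have "cmod (z - \<xi>) \<le> q"
  proof -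
    have eq: "z - \<xi> = complex_of_real (cmod b - 1) * \<xi>"
      by (simp add: z_def left_diff_distrib)
    have "cmod (z - \<xi>) = \<bar>cmod b - 1\<bar>"
      unfolding eq norm_mult norm_of_real using \<xi> by simp
    also have "\<dots> = 1 - cmod b"
      using b by simp
    also have "\<dots> \<le> q"
      using b mult_left_le[of "cmod b" "cmod b"] by (simp add: q_def power2_eq_square)
    finally show ?thesis .
  qed
  ultimately have "cmod (z - b) \<le> q * (1 / d + 1)"
    using norm_triangle_ineq[of "z - \<xi>" "\<xi> - b"] by (simp add: algebra_simps)
  then have "(cmod (z - b))\<^sup>2 \<le> q\<^sup>2 * (1 / d + 1)\<^sup>2"
    using power_mono[of "cmod (z - b)" "q * (1 / d + 1)" 2] by (simp add: power_mult_distrib)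
  then have "(cmod (z - b))\<^sup>2 / (q * q) \<le> (1 / d + 1)\<^sup>2"
    using q by (simp add: divide_le_eq power2_eq_square mult_ac)
  then have "arcosh (1 + 2 * ((cmod (z - b))\<^sup>2 / (q * q))) \<le> arcosh (1 + 2 * (1 / d + 1)\<^sup>2)"
    using q by (intro arcosh_mono) auto
  also have "arcosh (1 + 2 * ((cmod (z - b))\<^sup>2 / (q * q))) = hdist z b"
    unfolding hdist_def q_def z by simp
  also have "\<dots> = hdist (f z) (f b)"
    using z b by (intro conformal_factor_hdist[OF f, symmetric]) auto
  finally show ?thesis
    unfolding b z_def .
qed

section \<open>Inversions in circles orthogonal to the unit circle\<close>

text \<open>This is \<open>c + r^2 / cnj (z - c)\<close> with \<open>r^2 = (cmod c)^2 - 1\<close>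
  substituted: a circle orthogonal to the unit circle is determined by its center.\<close>

definition inversion :: "complex \<Rightarrow> complex \<Rightarrow> complex" where
  "inversion c z = (c * cnj z - 1) / (cnj z - cnj c)"

context
  fixes c :: complex and r :: real
  assumes c: "(cmod c)\<^sup>2 = 1 + r\<^sup>2" and r: "0 < r"
begin

lemma center_neq: "cmod z \<le> 1 \<Longrightarrow> z \<noteq> c"
  using c r power_mono[of "cmod z" 1 2] by auto

lemma inversion_minus_center:
  assumes "z \<noteq> c"
  shows "inversion c z - c = of_real (r\<^sup>2) / cnj (z - c)"
proof -
  have "c * cnj c = 1 + of_real (r\<^sup>2)"
    using arg_cong[OF c, of complex_of_real] by (simp only: complex_norm_square) simp
  moreover have "cnj z - cnj c \<noteq> 0"
    using assms by (simp flip: complex_cnj_diff)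
  ultimately show ?thesis
    by (simp add: inversion_def field_simps)
qed

lemma cmod_inversion_minus_center:
  assumes "z \<noteq> c"
  shows "cmod (inversion c z - c) = r\<^sup>2 / cmod (z - c)"
  unfolding inversion_minus_center[OF assms] norm_divide complex_mod_cnj norm_of_real by simp

lemma inversion_inversion:
  assumes "z \<noteq> c"
  shows "inversion c (inversion c z) = z"
proof -
  have "inversion c z \<noteq> c"
    using inversion_minus_center[OF assms] r assms by auto
  from inversion_minus_center[OF this]
  have "inversion c (inversion c z) - c = of_real (r\<^sup>2) / cnj (inversion c z - c)" .
  also have "\<dots> = z - c"
    unfolding inversion_minus_center[OF assms] using r by simp
  finally show ?thesis by simp
qed

lemma cmod_inversion_diff:
  assumes "z \<noteq> c" "w \<noteq> c"
  shows "cmod (inversion c z - inversion c w) = r\<^sup>2 / (cmod (z - c) * cmod (w - c)) * cmod (z - w)"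
proof -
  have "inversion c z - inversion c w = of_real (r\<^sup>2) / cnj (z - c) - of_real (r\<^sup>2) / cnj (w - c)"
    unfolding inversion_minus_center[OF assms(1), symmetric]
      inversion_minus_center[OF assms(2), symmetric] by simp
  also have "\<dots> = of_real (r\<^sup>2) / (cnj (z - c) * cnj (w - c)) * cnj (w - z)"
    using assms by (simp add: field_simps)
  finally show ?thesis
    by (simp only: norm_mult norm_divide complex_mod_cnj norm_of_real norm_minus_commute[of w]) simp
qed

text \<open>Orthogonality enters here: it turns \<open>(cmod c)^2 - 1\<close> in the polynomial
  identity below into \<open>r^2\<close>, and so makes the unit disk invariant.\<close>

lemma one_minus_cmod_inversion:
  assumes "z \<noteq> c"
  shows "1 - (cmod (inversion c z))\<^sup>2 = (r / cmod (z - c))\<^sup>2 * (1 - (cmod z)\<^sup>2)"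
proof -
  have "(cmod (z - c))\<^sup>2 - (cmod (c * cnj z - 1))\<^sup>2 = ((cmod c)\<^sup>2 - 1) * (1 - (cmod z)\<^sup>2)"
    unfolding cmod_power2 by (simp add: power2_eq_square algebra_simps)
  then have "(cmod (z - c))\<^sup>2 - (cmod (c * cnj z - 1))\<^sup>2 = r\<^sup>2 * (1 - (cmod z)\<^sup>2)"
    using c by simp
  moreover have "cmod (inversion c z) = cmod (c * cnj z - 1) / cmod (z - c)"
    unfolding inversion_def norm_divide complex_cnj_diff[symmetric] complex_mod_cnj ..
  moreover have "0 < cmod (z - c)"
    using assms by simp
  ultimately show ?thesis
    by (simp add: power_divide diff_divide_eq_iff)
qed

lemma conformal_factor_inversion: "conformal_factor (inversion c) (\<lambda>z. (r / cmod (z - c))\<^sup>2)"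
  unfolding conformal_factor_def
proof (intro ballI conjI)
  fix z :: complex assume "z \<in> cball 0 1"
  then have z: "z \<noteq> c" using center_neq by auto
  show "0 < (r / cmod (z - c))\<^sup>2"
    using z r by simp
  show "1 - (cmod (inversion c z))\<^sup>2 = (r / cmod (z - c))\<^sup>2 * (1 - (cmod z)\<^sup>2)"
    by (rule one_minus_cmod_inversion[OF z])
  fix w :: complex assume "w \<in> cball 0 1"
  then have w: "w \<noteq> c" using center_neq by auto
  show "(cmod (inversion c z - inversion c w))\<^sup>2
      = (r / cmod (z - c))\<^sup>2 * (r / cmod (w - c))\<^sup>2 * (cmod (z - w))\<^sup>2"
    unfolding cmod_inversion_diff[OF z w] by (simp add: power_mult_distrib power_divide power2_eq_square mult_ac)
qed

lemma isCont_inversion: "z \<noteq> c \<Longrightarrow> isCont (inversion c) z"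
  unfolding inversion_def by (intro continuous_intros) (simp flip: complex_cnj_diff)

end

section \<open>The mirrors\<close>

text \<open>The Cayley transform of the real line, sending \<open>x\<close> to the angle
  \<open>2 * arctan x\<close>. Being rational, it has chord lengths in closed form, and
  \<open>circle_pt 0 = 1\<close>.\<close>

definition circle_pt :: "real \<Rightarrow> complex" where
  "circle_pt x = (1 + \<i> * x) / (1 - \<i> * x)"

definition mirror_pos :: "nat \<Rightarrow> real" where
  "mirror_pos n = (1/2) ^ n"

text \<open>The exponent \<open>n * n\<close> makes all positive powers of the contraction factors
  summable. The extra 4 gives \<open>mirror_radius n \<le> mirror_pos n / 16\<close>, which keeps
  the discs apart.\<close>

definition mirror_radius :: "nat \<Rightarrow> real" where
  "mirror_radius n = (1/2) ^ (n * n + 4) * mirror_pos n"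

definition mirror_center :: "nat \<Rightarrow> complex" where
  "mirror_center n = of_real (sqrt (1 + (mirror_radius n)\<^sup>2)) * circle_pt (mirror_pos n)"

text \<open>Half the radius of the mirror: inversion exchanges distance at least
  \<open>2 * r\<close> from the center with distance at most \<open>r / 2\<close>. The discs are
  closed so that they retain limits of orbit points.\<close>

definition mirror_disc :: "nat \<Rightarrow> complex set" where
  "mirror_disc n = cball (mirror_center n) (mirror_radius n / 2)"

definition reflect :: "nat \<Rightarrow> complex \<Rightarrow> complex" where
  "reflect n = inversion (mirror_center n)"

text \<open>A distance of at least four mirror radii, measured on the scale of
  \<open>mirror_pos n\<close>. One condition serves both ping-pong and the contraction
  estimate.\<close>

definition away :: "nat \<Rightarrow> complex \<Rightarrow> bool" where
  "away n z \<longleftrightarrow> mirror_pos n / 4 \<le> cmod (z - mirror_center n)"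

section \<open>Chord lengths in the Cayley parametrisation\<close>

lemma cmod_one_ii: "cmod (1 + \<i> * of_real x) = sqrt (1 + x\<^sup>2)" "cmod (1 - \<i> * of_real x) = sqrt (1 + x\<^sup>2)"
  by (simp_all add: cmod_def)

lemma cmod_circle_pt: "cmod (circle_pt x) = 1"
proof -
  have "sqrt (1 + x\<^sup>2) \<noteq> 0"
    by (metis add_less_same_cancel1 not_sum_power2_lt_zero one_power2 real_sqrt_eq_zero_cancel_iff
        sum_power2_eq_zero_iff zero_neq_one)
  then show ?thesis
    unfolding circle_pt_def norm_divide cmod_one_ii by simp
qed

lemma cmod_circle_pt_diff:
  "cmod (circle_pt x - circle_pt y) = 2 * \<bar>x - y\<bar> / (sqrt (1 + x\<^sup>2) * sqrt (1 + y\<^sup>2))"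
proof -
  have nz: "1 - \<i> * of_real t \<noteq> 0" for t :: real
    by (simp add: complex_eq_iff)
  have "circle_pt x - circle_pt y = 2 * \<i> * of_real (x - y) / ((1 - \<i> * of_real x) * (1 - \<i> * of_real y))"
    unfolding circle_pt_def using nz[of x] nz[of y] by (simp add: field_simps)
  then show ?thesis
    by (simp only: norm_divide norm_mult cmod_one_ii norm_of_real) simp
qed

lemma circle_pt_diff_ge:
  assumes "x \<in> {0..1}" "y \<in> {0..1}"
  shows "\<bar>x - y\<bar> \<le> cmod (circle_pt x - circle_pt y)"
proof -
  have "sqrt (1 + t\<^sup>2) \<le> sqrt 2" if "t \<in> {0..1}" for t :: real
    using that power_mono[of t 1 2] by simp
  then have "sqrt (1 + x\<^sup>2) * sqrt (1 + y\<^sup>2) \<le> sqrt 2 * sqrt 2"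
    using assms by (intro mult_mono) auto
  then have "2 * \<bar>x - y\<bar> / 2 \<le> cmod (circle_pt x - circle_pt y)"
    unfolding cmod_circle_pt_diff by (intro divide_left_mono) (auto intro!: mult_pos_pos add_pos_nonneg)
  then show ?thesis by simp
qed

lemma circle_pt_diff_le: "cmod (circle_pt x - circle_pt y) \<le> 2 * \<bar>x - y\<bar>"
proof -
  have "1 * 1 \<le> sqrt (1 + x\<^sup>2) * sqrt (1 + y\<^sup>2)"
    by (intro mult_mono) auto
  then have "2 * \<bar>x - y\<bar> / (sqrt (1 + x\<^sup>2) * sqrt (1 + y\<^sup>2)) \<le> 2 * \<bar>x - y\<bar> / 1"
    by (intro divide_left_mono) auto
  then show ?thesis
    unfolding cmod_circle_pt_diff by simp
qed

section \<open>Positions and sizes of the mirrors\<close>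

lemma mirror_pos_bounds: "0 < mirror_pos n" "mirror_pos n \<le> 1"
  by (simp_all add: mirror_pos_def power_le_one)

lemma mirror_pos_diff:
  assumes "m \<noteq> n"
  shows "max (mirror_pos m) (mirror_pos n) / 2 \<le> \<bar>mirror_pos m - mirror_pos n\<bar>"
  using assms
proof (induction m n rule: linorder_wlog)
  case (le m n)
  then have "Suc m \<le> n" by simp
  then have "mirror_pos n \<le> mirror_pos m / 2"
    using power_decreasing[of "Suc m" n "1/2::real"] by (simp add: mirror_pos_def)
  with mirror_pos_bounds[of m] show ?case by (simp add: max_def)
next
  case (sym m n)
  then show ?case by (simp add: max.commute abs_minus_commute)
qed

lemma mirror_radius_pos: "0 < mirror_radius n"
  by (simp add: mirror_radius_def mirror_pos_bounds)

lemma mirror_radius_le: "mirror_radius n \<le> mirror_pos n / 16"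
proof -
  have "(1/2::real) ^ (n * n + 4) \<le> (1/2) ^ 4"
    by (rule power_decreasing) auto
  then have "(1/2) ^ (n * n + 4) * mirror_pos n \<le> (1/16) * mirror_pos n"
    using mirror_pos_bounds[of n] by (intro mult_right_mono) (auto simp: power_divide)
  then show ?thesis
    by (simp add: mirror_radius_def)
qed

lemma cmod_mirror_center: "(cmod (mirror_center n))\<^sup>2 = 1 + (mirror_radius n)\<^sup>2"
  by (simp add: mirror_center_def norm_mult cmod_circle_pt)

lemma mirror_center_near: "cmod (mirror_center n - circle_pt (mirror_pos n)) \<le> mirror_radius n"
proof -
  let ?r = "mirror_radius n" and ?u = "circle_pt (mirror_pos n)"
  have "sqrt (1 + ?r\<^sup>2) \<le> 1 + ?r"
    using mirror_radius_pos[of n] by (intro real_le_lsqrt) (auto simp: power2_eq_square algebra_simps)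
  moreover have "1 \<le> sqrt (1 + ?r\<^sup>2)" by simp
  moreover have eq: "mirror_center n - ?u = of_real (sqrt (1 + ?r\<^sup>2) - 1) * ?u"
    by (simp add: mirror_center_def left_diff_distrib)
  ultimately show ?thesis
    unfolding eq norm_mult norm_of_real cmod_circle_pt by simp
qed

lemma cmod_mirror_center_ge_1: "1 \<le> cmod (mirror_center n)"
  by (simp add: mirror_center_def norm_mult cmod_circle_pt)

lemma dist_mirror_disc:
  assumes "z \<in> mirror_disc n"
  shows "cmod (z - circle_pt (mirror_pos n)) \<le> 2 * mirror_radius n"
proof -
  have "cmod (z - mirror_center n) \<le> mirror_radius n / 2"
    using assms by (simp add: mirror_disc_def dist_norm norm_minus_commute)
  then show ?thesis
    using mirror_center_near[of n] mirror_radius_pos[of n]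
      norm_triangle_ineq[of "z - mirror_center n" "mirror_center n - circle_pt (mirror_pos n)"]
    by simp
qed

section \<open>Separation of the discs and contraction by the reflections\<close>

lemma away_0: "away n 0"
  using cmod_mirror_center_ge_1[of n] mirror_pos_bounds[of n] by (simp add: away_def)

text \<open>The mirrors accumulate at \<open>1 = circle_pt 0\<close>, which by
  \<open>limit_set_cases\<close> is the only limit point that can lie outside all discs and so needs
  its own check.\<close>

lemma away_1: "away n 1"
proof -
  have "\<bar>mirror_pos n - 0\<bar> \<le> cmod (circle_pt (mirror_pos n) - circle_pt 0)"
    using mirror_pos_bounds[of n] by (intro circle_pt_diff_ge) auto
  also have "\<dots> \<le> cmod (1 - mirror_center n) + mirror_radius n"
    using norm_triangle_ineq[of "1 - mirror_center n" "mirror_center n - circle_pt (mirror_pos n)"]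
      mirror_center_near[of n] by (simp add: circle_pt_def norm_minus_commute)
  finally show ?thesis
    using mirror_radius_le[of n] mirror_pos_bounds[of n] by (simp add: away_def)
qed

text \<open>With \<open>x\<close> the larger position, the two circle points are at least
  \<open>x / 2\<close> apart. The disc \<open>m\<close> costs at most \<open>x / 8\<close> and the
  shift of center \<open>n\<close> at most \<open>x / 16\<close>, which leaves
  \<open>5 * x / 16\<close>.\<close>

lemma away_mirror_disc:
  assumes "z \<in> mirror_disc m" "m \<noteq> n"
  shows "away n z"
proof -
  let ?u = "\<lambda>n. circle_pt (mirror_pos n)"
  have "max (mirror_pos m) (mirror_pos n) / 2 \<le> \<bar>mirror_pos m - mirror_pos n\<bar>"
    by (rule mirror_pos_diff[OF assms(2)])
  also have "\<dots> \<le> cmod (?u m - ?u n)"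
    using mirror_pos_bounds by (intro circle_pt_diff_ge) (auto intro: less_imp_le)
  also have "\<dots> \<le> cmod (?u m - z) + cmod (z - mirror_center n) + cmod (mirror_center n - ?u n)"
    using norm_triangle_ineq[of "?u m - z" "z - mirror_center n"]
      norm_triangle_ineq[of "?u m - mirror_center n" "mirror_center n - ?u n"] by simp
  finally show ?thesis
    using dist_mirror_disc[OF assms(1)] mirror_center_near[of n] mirror_radius_le[of n]
      mirror_radius_le[of m] mirror_pos_bounds[of n] mirror_pos_bounds[of m]
    by (simp add: away_def norm_minus_commute max_def split: if_splits)
qed

lemma away_not_in_mirror_disc: "away n z \<Longrightarrow> z \<notin> mirror_disc n"
  using mirror_radius_le[of n] mirror_pos_bounds[of n]
  by (auto simp: away_def mirror_disc_def dist_norm norm_minus_commute)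

lemma mirror_disc_disjoint: "z \<in> mirror_disc m \<Longrightarrow> z \<in> mirror_disc n \<Longrightarrow> m = n"
  using away_mirror_disc away_not_in_mirror_disc by blast

lemmas mirror_center_neq = center_neq[OF cmod_mirror_center mirror_radius_pos]

lemma reflect_reflect: "cmod z \<le> 1 \<Longrightarrow> reflect n (reflect n z) = z"
  unfolding reflect_def
  by (intro inversion_inversion[OF cmod_mirror_center mirror_radius_pos] mirror_center_neq)

lemma conformal_factor_reflect:
  "conformal_factor (reflect n) (\<lambda>z. (mirror_radius n / cmod (z - mirror_center n))\<^sup>2)"
  unfolding reflect_def by (rule conformal_factor_inversion[OF cmod_mirror_center mirror_radius_pos])

lemma cmod_reflect_eq_1: "cmod z = 1 \<Longrightarrow> cmod (reflect n z) = 1"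
  using conformal_factorD(2)[OF conformal_factor_reflect, of z n] by (simp add: power2_eq_1_iff)
    (metis abs_norm_cancel abs_minus abs_one)

lemma reflect_away_in_mirror_disc:
  assumes "cmod z \<le> 1" "away n z"
  shows "reflect n z \<in> mirror_disc n"
proof -
  let ?r = "mirror_radius n"
  have d: "2 * ?r \<le> cmod (z - mirror_center n)" "0 < cmod (z - mirror_center n)"
    using assms mirror_radius_le[of n] mirror_pos_bounds[of n] by (auto simp: away_def)
  have "cmod (reflect n z - mirror_center n) = ?r\<^sup>2 / cmod (z - mirror_center n)"
    unfolding reflect_def using assms
    by (intro cmod_inversion_minus_center[OF cmod_mirror_center mirror_radius_pos] mirror_center_neq)
  also have "\<dots> \<le> ?r / 2"
  proof -
    have "?r * (2 * ?r) \<le> ?r * cmod (z - mirror_center n)"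
      using d mirror_radius_pos[of n] by (intro mult_left_mono) auto
    then show ?thesis
      using d by (simp add: divide_le_eq power2_eq_square)
  qed
  finally show ?thesis
    by (simp add: mirror_disc_def dist_norm norm_minus_commute)
qed

lemma reflect_mirror_disc:
  assumes "cmod z \<le> 1" "z \<in> mirror_disc n"
  shows "2 * mirror_radius n \<le> cmod (reflect n z - mirror_center n)"
proof -
  let ?r = "mirror_radius n"
  have d: "cmod (z - mirror_center n) \<le> ?r / 2" "0 < cmod (z - mirror_center n)"
    using assms mirror_center_neq[of z] by (auto simp: mirror_disc_def dist_norm norm_minus_commute)
  have "2 * ?r * cmod (z - mirror_center n) \<le> 2 * ?r * (?r / 2)"
    using d mirror_radius_pos[of n] by (intro mult_left_mono) auto
  then have "2 * ?r * cmod (z - mirror_center n) \<le> ?r\<^sup>2"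
    by (simp add: power2_eq_square)
  then have "2 * ?r \<le> ?r\<^sup>2 / cmod (z - mirror_center n)"
    by (simp only: pos_le_divide_eq[OF d(2)])
  also have "\<dots> = cmod (reflect n z - mirror_center n)"
    unfolding reflect_def using assms
    by (intro cmod_inversion_minus_center[OF cmod_mirror_center mirror_radius_pos, symmetric] mirror_center_neq)
  finally show ?thesis .
qed

text \<open>In the quotient of radius by position \<open>mirror_pos n\<close> cancels, leaving
  \<open>16 * ((1/2) ^ (n * n + 4))^2\<close>. Of this one factor \<open>(1/2) ^ (n * n)\<close> is
  given away, and the 1/16 is kept to pay for the passage from chords to angles.\<close>

lemma reflect_contraction:
  assumes "cmod z \<le> 1" "cmod w \<le> 1" "away n z" "away n w"
  shows "cmod (reflect n z - reflect n w) \<le> (1/2) ^ (n * n) / 16 * cmod (z - w)"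
proof -
  let ?r = "mirror_radius n" and ?x = "mirror_pos n"
  have "(?x / 4) * (?x / 4) \<le> cmod (z - mirror_center n) * cmod (w - mirror_center n)"
    using assms mirror_pos_bounds[of n] by (intro mult_mono) (auto simp: away_def)
  then have "?r\<^sup>2 / (cmod (z - mirror_center n) * cmod (w - mirror_center n)) \<le> ?r\<^sup>2 / ((?x / 4) * (?x / 4))"
    using mirror_pos_bounds[of n] assms(1,2) mirror_center_neq
    by (intro divide_left_mono) (auto intro!: mult_pos_pos)
  also have "\<dots> = 16 * ((1/2) ^ (n * n + 4))\<^sup>2"
    using mirror_pos_bounds(1)[of n] by (simp add: mirror_radius_def power2_eq_square)
  also have "\<dots> = (1/2) ^ (n * n) / 16 * (1/2) ^ (n * n)"
    by (simp add: power_add power2_eq_square power_divide)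
  also have "\<dots> \<le> (1/2) ^ (n * n) / 16"
    by (intro mult_right_le_one_le) (auto intro!: power_le_one)
  finally have "?r\<^sup>2 / (cmod (z - mirror_center n) * cmod (w - mirror_center n)) * cmod (z - w)
      \<le> (1/2) ^ (n * n) / 16 * cmod (z - w)"
    by (intro mult_right_mono) auto
  then show ?thesis
    unfolding reflect_def
      cmod_inversion_diff[OF cmod_mirror_center mirror_radius_pos mirror_center_neq[OF assms(1)]
        mirror_center_neq[OF assms(2)]] .
qed

lemma reflect_ang_contraction:
  assumes "cmod z = 1" "cmod w = 1" "away n z" "away n w"
  shows "ang_dist (reflect n z) (reflect n w) \<le> (1/2) ^ (n * n) * ang_dist z w"
proof -
  have "ang_dist (reflect n z) (reflect n w) \<le> 3 * cmod (reflect n z - reflect n w)"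
    using assms by (intro ang_dist_le_chord cmod_reflect_eq_1) auto
  also have "\<dots> \<le> 3 * ((1/2) ^ (n * n) / 16 * cmod (z - w))"
    using assms by (intro mult_left_mono reflect_contraction) auto
  also have "\<dots> \<le> (1/2) ^ (n * n) * cmod (z - w)"
    using mult_nonneg_nonneg[of "(1/2::real) ^ (n * n)" "cmod (z - w)"] by simp
  also have "\<dots> \<le> (1/2) ^ (n * n) * ang_dist z w"
    using assms by (intro mult_left_mono chord_le_ang_dist) auto
  finally show ?thesis .
qed

lemma hausdorff_content_reflect_le:
  assumes "A \<subseteq> sphere 0 1" "\<And>z. z \<in> A \<Longrightarrow> away n z" "0 \<le> s"
  shows "hausdorff_content s (reflect n ` A) \<le> ennreal (((1/2) ^ (n * n)) powr s) * hausdorff_content s A"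
  using assms by (intro hausdorff_content_image_le reflect_ang_contraction)
    (auto intro!: cmod_reflect_eq_1)

section \<open>The reflection group\<close>

text \<open>\<open>hisom\<close> asks for the identity off the disk, while the coding needs the
  action on the boundary circle. Hence words \<open>foldr reflect ns\<close> act on the closed disk
  and only group elements are cut off.\<close>

definition on_disk :: "(complex \<Rightarrow> complex) \<Rightarrow> complex \<Rightarrow> complex" where
  "on_disk f z = (if z \<in> hdisk then f z else z)"

text \<open>The letters range over a set \<open>I\<close> so that subgroups on finitely many letters
  can be compared with the whole group.\<close>

definition reflection_group :: "nat set \<Rightarrow> (complex \<Rightarrow> complex) set" where
  "reflection_group I = (\<lambda>ns. on_disk (foldr reflect ns)) ` lists I"

lemma conformal_factor_word: "\<exists>m. conformal_factor (foldr reflect ns) m"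
proof (induction ns)
  case Nil
  then show ?case using conformal_factor_id by (auto simp: id_def)
next
  case (Cons n ns)
  then show ?case using conformal_factor_compose[OF conformal_factor_reflect] by (auto simp: comp_def)
qed

lemma cmod_word_le_1: "cmod z \<le> 1 \<Longrightarrow> cmod (foldr reflect ns z) \<le> 1"
  using conformal_factor_word[of ns] conformal_factor_cmod_le_1 by blast

lemma word_in_hdisk: "z \<in> hdisk \<Longrightarrow> foldr reflect ns z \<in> hdisk"
  using conformal_factor_word[of ns] conformal_factor_cmod_less_1 by (auto simp: hdisk_def)

lemma word_rev_word: "cmod z \<le> 1 \<Longrightarrow> foldr reflect (rev ns) (foldr reflect ns z) = z"
  by (induction ns arbitrary: z) (auto simp: reflect_reflect cmod_word_le_1)

lemma on_disk_word_comp: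
  "on_disk (foldr reflect ms) \<circ> on_disk (foldr reflect ns) = on_disk (foldr reflect (ms @ ns))"
  by (auto simp: on_disk_def word_in_hdisk)

lemma on_disk_word_rev_comp: "on_disk (foldr reflect (rev ns)) \<circ> on_disk (foldr reflect ns) = id"
  unfolding on_disk_word_comp
  by (auto simp: on_disk_def word_rev_word hdisk_def fun_eq_iff)

lemma hisom_word: "hisom (on_disk (foldr reflect ns))"
proof -
  let ?f = "on_disk (foldr reflect ns)" and ?g = "on_disk (foldr reflect (rev ns))"
  have "?g (?f z) = z" "?f (?g z) = z" for z
    using fun_cong[OF on_disk_word_rev_comp[of ns], of z]
      fun_cong[OF on_disk_word_rev_comp[of "rev ns"], of z] by auto
  moreover have "?f \<in> hdisk \<rightarrow> hdisk" "?g \<in> hdisk \<rightarrow> hdisk"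
    by (auto simp: on_disk_def word_in_hdisk)
  ultimately have "bij_betw ?f hdisk hdisk"
    by (intro bij_betwI[of _ _ _ ?g]) auto
  moreover obtain m where "conformal_factor (foldr reflect ns) m"
    using conformal_factor_word by blast
  then have "hdist (?f z) (?f w) = hdist z w" if "z \<in> hdisk" "w \<in> hdisk" for z w
    using that conformal_factor_hdist by (auto simp: on_disk_def hdisk_def)
  ultimately show ?thesis
    by (auto simp: hisom_def on_disk_def)
qed

lemma isom_subgroup_reflection_group: "isom_subgroup (reflection_group I)"
  unfolding isom_subgroup_def
proof (intro conjI ballI)
  show "hisom g" if "g \<in> reflection_group I" for g
    using that by (auto simp: reflection_group_def hisom_word)
  have "on_disk (foldr reflect []) = id"
    by (auto simp: on_disk_def)
  then show "id \<in> reflection_group I"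
    unfolding reflection_group_def by (metis imageI lists.Nil)
  show "g \<circ> h \<in> reflection_group I" if gh: "g \<in> reflection_group I" "h \<in> reflection_group I" for g h
  proof -
    obtain ms ns where "g = on_disk (foldr reflect ms)" "h = on_disk (foldr reflect ns)"
      and "ms \<in> lists I" "ns \<in> lists I"
      using gh by (auto simp: reflection_group_def)
    then show ?thesis
      unfolding reflection_group_def by (auto simp: on_disk_word_comp intro!: imageI)
  qed
  show "inv g \<in> reflection_group I" if g: "g \<in> reflection_group I" for g
  proof -
    obtain ns where ns: "g = on_disk (foldr reflect ns)" "ns \<in> lists I"
      using g by (auto simp: reflection_group_def)
    have "inv g = on_disk (foldr reflect (rev ns))"
      unfolding ns(1) using on_disk_word_rev_comp[of ns] on_disk_word_rev_comp[of "rev ns"]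
      by (intro inv_unique_comp) auto
    then show ?thesis
      using ns(2) by (auto simp: reflection_group_def)
  qed
qed

section \<open>Reduced words, discreteness and infinite generation\<close>

text \<open>Equal adjacent letters cancel because reflections are involutions on the closed disk,
  where the pole is avoided; hence equality is claimed only there.\<close>

lemma reduced_word:
  "\<exists>ms. distinct_adj ms \<and> set ms \<subseteq> set ns \<and> (\<forall>z. cmod z \<le> 1 \<longrightarrow> foldr reflect ms z = foldr reflect ns z)"
proof (induction ns)
  case (Cons n ns)
  then obtain ms where ms: "distinct_adj ms" "set ms \<subseteq> set ns"
    "\<And>z. cmod z \<le> 1 \<Longrightarrow> foldr reflect ms z = foldr reflect ns z"
    by blast
  show ?case
  proof (cases "ms \<noteq> [] \<and> hd ms = n")
    case True
    then obtain ks where ks: "ms = n # ks"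
      by (cases ms) auto
    have "foldr reflect ks z = foldr reflect (n # ns) z" if "cmod z \<le> 1" for z
      using ms(3)[OF that, symmetric] by (simp add: ks reflect_reflect cmod_word_le_1 that)
    then show ?thesis
      using ms(1,2) by (intro exI[of _ ks]) (auto simp: ks distinct_adj_Cons)
  next
    case False
    then show ?thesis
      using ms by (intro exI[of _ "n # ms"]) (auto simp: distinct_adj_Cons)
  qed
qed auto

text \<open>The head letter acts last. The tail has already moved 0 into the disc of a different
  letter, which is away from mirror \<open>n\<close>.\<close>

lemma reduced_word_ping_pong:
  "distinct_adj (n # ns) \<Longrightarrow> foldr reflect (n # ns) 0 \<in> mirror_disc n"
proof (induction ns arbitrary: n)
  case Nil
  then show ?case by (simp add: reflect_away_in_mirror_disc away_0)
next
  case (Cons m ns)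
  then have "foldr reflect (m # ns) 0 \<in> mirror_disc m" "m \<noteq> n"
    by auto
  then have "away n (foldr reflect (m # ns) 0)"
    by (rule away_mirror_disc)
  then show ?case
    using reflect_away_in_mirror_disc[OF cmod_word_le_1[of 0 "m # ns"]] by simp
qed

lemma reflection_group_cases:
  assumes "g \<in> reflection_group I"
  shows "g = id \<or> (\<exists>n\<in>I. g 0 \<in> mirror_disc n)"
proof -
  obtain ns where ns: "g = on_disk (foldr reflect ns)" "ns \<in> lists I"
    using assms by (auto simp: reflection_group_def)
  obtain ms where ms: "distinct_adj ms" "set ms \<subseteq> set ns"
    "\<And>z. cmod z \<le> 1 \<Longrightarrow> foldr reflect ms z = foldr reflect ns z"
    using reduced_word[of ns] by blast
  have g: "g = on_disk (foldr reflect ms)"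
    using ms(3) by (auto simp: ns on_disk_def hdisk_def fun_eq_iff)
  show ?thesis
  proof (cases ms)
    case Nil
    then show ?thesis by (auto simp: g on_disk_def)
  next
    case (Cons n ks)
    then have "g 0 \<in> mirror_disc n"
      using reduced_word_ping_pong[of n ks] ms(1) by (simp add: g on_disk_def hdisk_def)
    moreover have "n \<in> I"
      using Cons ms(2) ns(2) by auto
    ultimately show ?thesis by blast
  qed
qed

lemma cmod_ge_half_mirror_disc:
  assumes "z \<in> mirror_disc n"
  shows "1/2 \<le> cmod z"
  using dist_mirror_disc[OF assms] mirror_radius_le[of n] mirror_pos_bounds[of n]
    norm_triangle_ineq2[of "circle_pt (mirror_pos n)" "circle_pt (mirror_pos n) - z"]
  by (simp add: cmod_circle_pt norm_minus_commute)

lemma discrete_reflection_group: "discrete_isom_subgroup (reflection_group I)"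
proof -
  have "g = id"
    if g: "g \<in> reflection_group I"
      \<comment> \<open>Only \<open>x = 0\<close> is tested, so the radius 1 is arbitrary. The value
        \<open>arcosh (5/3)\<close> is the hyperbolic distance from 0 to a point of modulus
        1/2.\<close>
      and near: "\<forall>x\<in>hdisk. hdist x 0 \<le> 1 \<longrightarrow> hdist (g x) x < arcosh (5/3)" for g
  proof (rule ccontr)
    assume "g \<noteq> id"
    then obtain n where "g 0 \<in> mirror_disc n"
      using reflection_group_cases[OF g] by auto
    then have half: "1/2 \<le> cmod (g 0)"
      by (rule cmod_ge_half_mirror_disc)
    have "g 0 \<in> hdisk"
      using g by (auto simp: reflection_group_def on_disk_def word_in_hdisk hdisk_def)
        (use word_in_hdisk[of 0] in \<open>auto simp: hdisk_def\<close>)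
    then have q: "0 < 1 - (cmod (g 0))\<^sup>2"
      using cmod_less_1_iff[of "g 0"] by (simp add: hdisk_def)
    moreover have "1/4 \<le> (cmod (g 0))\<^sup>2"
      using power_mono[OF half, of 2] by (simp add: power2_eq_square)
    ultimately have "5/3 \<le> 1 + 2 * (cmod (g 0))\<^sup>2 / (1 - (cmod (g 0))\<^sup>2)"
      by (simp add: field_simps)
    then have "arcosh (5/3) \<le> hdist (g 0) 0"
      by (simp add: hdist_def arcosh_mono)
    moreover have "hdist (g 0) 0 < arcosh (5/3)"
      using near[rule_format, of 0] by (simp add: hdisk_def hdist_def[of 0])
    ultimately show False by simp
  qed
  moreover have "0 < arcosh (5/3 :: real)"
    by simp
  ultimately show ?thesis
    unfolding discrete_isom_subgroup_def
    by (intro conjI isom_subgroup_reflection_group exI[of _ "1::real"] exI[of _ "arcosh (5/3)"]) auto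
qed

text \<open>Finitely many generators use only letters below some \<open>M\<close>. Reflection
  \<open>M\<close> moves 0 into disc \<open>M\<close>, whereas the nontrivial elements on smaller
  letters move it into smaller discs.\<close>

lemma not_finitely_generated_reflection_group: "\<not> finitely_generated (reflection_group UNIV)"
proof
  assume "finitely_generated (reflection_group UNIV)"
  then obtain S where S: "finite S" "S \<subseteq> reflection_group UNIV"
    "gen_isom_subgroup S = reflection_group UNIV"
    by (auto simp: finitely_generated_def)
  obtain W where W: "finite W" "S = (\<lambda>ns. on_disk (foldr reflect ns)) ` W"
    using S(1,2) unfolding reflection_group_def by (meson finite_subset_image)
  obtain M where M: "(\<Union>ns\<in>W. set ns) \<subseteq> {..<M}"
    using W(1) finite_nat_iff_bounded by (meson List.finite_set finite_UN_I)
  have "S \<subseteq> reflection_group {..<M}"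
    unfolding W(2) reflection_group_def by (rule image_mono) (use M in auto)
  then have "gen_isom_subgroup S \<subseteq> reflection_group {..<M}"
    using isom_subgroup_reflection_group by (auto simp: gen_isom_subgroup_def)
  moreover have "on_disk (foldr reflect [M]) \<in> reflection_group UNIV"
    unfolding reflection_group_def by (intro imageI) auto
  ultimately have "on_disk (foldr reflect [M]) \<in> reflection_group {..<M}"
    using S(3) by auto
  then consider "on_disk (foldr reflect [M]) = id"
    | n where "n < M" "on_disk (foldr reflect [M]) 0 \<in> mirror_disc n"
    using reflection_group_cases by blast
  moreover have M0: "on_disk (foldr reflect [M]) 0 \<in> mirror_disc M"
    using reduced_word_ping_pong[of M "[]"] by (simp add: on_disk_def hdisk_def)
  ultimately show False
  proof cases
    case 1
    then show False
      using M0 away_not_in_mirror_disc[OF away_0] by simp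
  next
    case (2 n)
    then show False
      using M0 mirror_disc_disjoint by blast
  qed
qed

section \<open>The limit set and its coding\<close>

abbreviation mirror_limit_set :: "complex set" where
  "mirror_limit_set \<equiv> limit_set (reflection_group UNIV)"

text \<open>The orbit of 0 lies in a closed set made of 0, finitely many discs, and a ball about 1
  that contains all later orbit points but misses \<open>\<xi>\<close>.\<close>

lemma limit_set_cases:
  assumes "\<xi> \<in> mirror_limit_set" "\<xi> \<noteq> 1"
  obtains n where "\<xi> \<in> mirror_disc n"
proof (rule ccontr)
  assume "\<not> thesis"
  with that have none: "\<xi> \<notin> mirror_disc n" for n
    by blast
  define e where "e = cmod (\<xi> - 1) / 2"
  have e: "0 < e" "\<xi> \<notin> cball 1 e"
    using assms(2) by (auto simp: e_def dist_norm norm_minus_commute)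
  \<comment> \<open>Disc \<open>n\<close> lies within \<open>2 * x + x / 8 \<le> 3 * x\<close> of 1,
    where \<open>x = mirror_pos n\<close>; hence the division by 3.\<close>
  obtain N where N: "(1/2::real) ^ N < e / 3"
    using real_arch_pow_inv[of "e / 3" "1/2"] e by auto
  define K where "K = {0} \<union> cball 1 e \<union> (\<Union>n<N. mirror_disc n)"
  have "closed K"
    unfolding K_def mirror_disc_def by (intro closed_Un closed_UN) auto
  moreover have "(\<lambda>g. g 0) ` reflection_group UNIV \<subseteq> K"
  proof clarify
    fix g assume "g \<in> reflection_group UNIV"
    then consider "g 0 = 0" | n where "n < N" "g 0 \<in> mirror_disc n" | n where "N \<le> n" "g 0 \<in> mirror_disc n"
      using reflection_group_cases[of g UNIV] by (metis id_apply not_less)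
    then show "g 0 \<in> K"
    proof cases
      case (3 n)
      have "cmod (circle_pt (mirror_pos n) - circle_pt 0) \<le> 2 * mirror_pos n"
        using circle_pt_diff_le[of "mirror_pos n" 0] mirror_pos_bounds[of n] by simp
      moreover have "cmod (g 0 - circle_pt (mirror_pos n)) \<le> mirror_pos n / 8"
        using dist_mirror_disc[OF 3(2)] mirror_radius_le[of n] by simp
      ultimately have "cmod (g 0 - 1) \<le> 3 * mirror_pos n"
        using norm_triangle_ineq[of "g 0 - circle_pt (mirror_pos n)" "circle_pt (mirror_pos n) - 1"]
          mirror_pos_bounds[of n] by (simp add: circle_pt_def)
      also have "mirror_pos n \<le> (1/2) ^ N"
        unfolding mirror_pos_def using 3(1) by (intro power_decreasing) auto
      finally have "cmod (g 0 - 1) \<le> e"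
        using N by simp
      then show ?thesis
        by (simp add: K_def dist_norm norm_minus_commute)
    qed (auto simp: K_def)
  qed
  ultimately have "\<xi> \<in> K"
    using assms(1) by (auto simp: limit_set_def closed_limpt dest: islimpt_subset)
  moreover have "\<xi> \<noteq> 0"
    using assms(1) by (auto simp: limit_set_def)
  ultimately show False
    using e none by (auto simp: K_def)
qed

text \<open>The reflection preserves the orbit and is continuous at \<open>\<xi>\<close>.
  Injectivity keeps the images of nearby orbit points distinct from the image of
  \<open>\<xi>\<close>, so accumulation survives.\<close>

lemma reflect_limit_set:
  assumes "\<xi> \<in> mirror_limit_set"
  shows "reflect n \<xi> \<in> mirror_limit_set"
proof -
  let ?O = "(\<lambda>g. g 0) ` reflection_group UNIV" and ?c = "mirror_center n"
  have \<xi>: "cmod \<xi> = 1" "\<xi> islimpt ?O"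
    using assms by (auto simp: limit_set_def)
  have neq: "\<xi> \<noteq> ?c"
    using \<xi> by (intro mirror_center_neq) simp
  have inj: "reflect n y \<noteq> reflect n \<xi>" if "y \<noteq> \<xi>" "y \<noteq> ?c" for y
    using that neq inversion_inversion[OF cmod_mirror_center mirror_radius_pos]
    unfolding reflect_def by metis
  have "eventually (\<lambda>y. reflect n y \<noteq> reflect n \<xi>) (at \<xi>)"
    unfolding eventually_at_topological
    by (intro exI[of _ "- {?c}"]) (use neq inj in auto)
  moreover have "isCont (reflect n) \<xi>"
    unfolding reflect_def by (rule isCont_inversion[OF cmod_mirror_center mirror_radius_pos neq])
  ultimately have "reflect n \<xi> islimpt reflect n ` ?O"
    using \<xi>(2) by (intro islimpt_isCont_image) auto
  moreover have "reflect n ` ?O \<subseteq> ?O"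
  proof clarify
    fix g assume "g \<in> reflection_group UNIV"
    then obtain ns where "g = on_disk (foldr reflect ns)"
      by (auto simp: reflection_group_def)
    then have "reflect n (g 0) = on_disk (foldr reflect (n # ns)) 0"
      by (simp add: on_disk_def hdisk_def)
    then show "reflect n (g 0) \<in> ?O"
      unfolding reflection_group_def lists_UNIV by blast
  qed
  ultimately show ?thesis
    using \<xi>(1) cmod_reflect_eq_1 by (auto simp: limit_set_def dest: islimpt_subset)
qed

text \<open>The image is again a limit point and has left disc \<open>n\<close>, so it is 1 or lies
  in another disc.\<close>

lemma away_reflect_limit_set:
  assumes "\<xi> \<in> mirror_limit_set" "\<xi> \<in> mirror_disc n"
  shows "away n (reflect n \<xi>)"
proof (cases "reflect n \<xi> = 1")
  case False
  with reflect_limit_set[OF assms(1)] obtain m where m: "reflect n \<xi> \<in> mirror_disc m"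
    by (rule limit_set_cases)
  have "2 * mirror_radius n \<le> cmod (reflect n \<xi> - mirror_center n)"
    using assms by (intro reflect_mirror_disc) (auto simp: limit_set_def)
  then have "reflect n \<xi> \<notin> mirror_disc n"
    using mirror_radius_pos[of n] by (auto simp: mirror_disc_def dist_norm norm_minus_commute)
  with m show ?thesis
    by (metis away_mirror_disc)
qed (simp add: away_1)

text \<open>The expanding map of the coding: it deletes the first letter of an itinerary. Points
  outside all discs, among them 1, are fixed.\<close>

definition shift :: "complex \<Rightarrow> complex" where
  "shift z = (if \<exists>n. z \<in> mirror_disc n then reflect (THE n. z \<in> mirror_disc n) z else z)"

lemma shift_eq: "z \<in> mirror_disc n \<Longrightarrow> shift z = reflect n z"
  unfolding shift_def by (subst the_equality[of _ n]) (auto intro: mirror_disc_disjoint)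

lemma shift_limit_set: "\<xi> \<in> mirror_limit_set \<Longrightarrow> shift \<xi> \<in> mirror_limit_set"
  by (simp add: shift_def reflect_limit_set)

lemma funpow_shift_limit_set: "\<xi> \<in> mirror_limit_set \<Longrightarrow> (shift ^^ k) \<xi> \<in> mirror_limit_set"
  by (induction k) (auto simp: shift_limit_set)

lemma limit_set_eq_reflect_shift:
  assumes "\<xi> \<in> mirror_limit_set" "\<xi> \<in> mirror_disc n"
  shows "away n (shift \<xi>)" "\<xi> = reflect n (shift \<xi>)"
  using assms away_reflect_limit_set reflect_reflect[of \<xi> n]
  by (auto simp: shift_eq limit_set_def)

section \<open>Nonconical limit points\<close>

lemma mirror_radius_antimono:
  assumes "n \<le> N"
  shows "mirror_radius N \<le> mirror_radius n"
  unfolding mirror_radius_def mirror_pos_def using assms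
  by (intro mult_mono power_decreasing add_right_mono) auto

text \<open>The witness \<open>2 * ln y\<close> is twice the inverse hyperbolic tangent of
  \<open>b\<close>.\<close>

lemma tanh_half_surj:
  fixes b :: real
  assumes "0 \<le> b" "b < 1"
  shows "\<exists>t. tanh (t / 2) = b"
proof -
  define y where "y = sqrt ((1 + b) / (1 - b))"
  have y: "0 < y" "y\<^sup>2 = (1 + b) / (1 - b)"
    using assms by (auto simp: y_def)
  have "tanh (2 * ln y / 2) = (y\<^sup>2 - 1) / (y\<^sup>2 + 1)"
    using tanh_ln_real[OF y(1)] by simp
  also have "\<dots> = b"
    unfolding y(2) using assms by (simp add: field_simps)
  finally show ?thesis by blast
qed

text \<open>If letters below \<open>N\<close> recurred, the inverse prefix words would bring ray
  points arbitrarily far out back within a distance \<open>R\<close> of 0 that depends only on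
  \<open>N\<close>.\<close>

lemma nonconical_itinerary:
  assumes \<xi>: "\<xi> \<in> nonconical_limit_set (reflection_group UNIV)"
    and \<nu>: "\<And>k. (shift ^^ k) \<xi> \<in> mirror_disc (\<nu> k)"
  shows "\<exists>j. \<forall>k\<ge>j. N \<le> \<nu> k"
proof (rule ccontr)
  assume "\<not> ?thesis"
  then have frequent: "\<exists>k\<ge>j. \<nu> k < N" for j
    by (meson not_less)
  define \<zeta> where "\<zeta> = (\<lambda>k. (shift ^^ k) \<xi>)"
  have L: "\<xi> \<in> mirror_limit_set"
    using \<xi> by (simp add: nonconical_limit_set_def)
  have \<zeta>: "\<zeta> k \<in> mirror_limit_set" "\<zeta> k \<in> mirror_disc (\<nu> k)" "cmod (\<zeta> k) = 1" for k
    using funpow_shift_limit_set[OF L, of k] \<nu>[of k] by (auto simp: \<zeta>_def limit_set_def)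
  have step: "\<zeta> (Suc k) = reflect (\<nu> k) (\<zeta> k)" "\<zeta> k = reflect (\<nu> k) (\<zeta> (Suc k))"
    "away (\<nu> k) (\<zeta> (Suc k))" for k
    using limit_set_eq_reflect_shift[OF \<zeta>(1,2), of k] shift_eq[OF \<zeta>(2), of k]
    by (simp_all add: \<zeta>_def)
  have adj: "\<nu> k \<noteq> \<nu> (Suc k)" for k
    using away_not_in_mirror_disc[OF step(3)[of k]] \<zeta>(2)[of "Suc k"] by auto

  \<comment> \<open>The first \<open>k\<close> letters. The reversed word undoes them, so it acts on
    \<open>\<xi>\<close> as the \<open>k\<close>-fold shift.\<close>
  define w where "w = (\<lambda>k. map \<nu> [0..<k])"
  have fwd: "foldr reflect (rev (w k)) \<xi> = \<zeta> k" for k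
    by (induction k) (simp_all add: w_def \<zeta>_def step(1)[unfolded \<zeta>_def, simplified])
  have away_fwd: "away (\<nu> k) (foldr reflect (rev (w k)) 0)" for k
  proof (induction k)
    case (Suc k)
    then have "foldr reflect (rev (w (Suc k))) 0 \<in> mirror_disc (\<nu> k)"
      by (simp add: w_def reflect_away_in_mirror_disc cmod_word_le_1)
    then show ?case
      using adj[of k] by (rule away_mirror_disc)
  qed (simp add: w_def away_0)

  \<comment> \<open>The start \<open>j\<close> is a parameter because peeling off the outermost
    letter moves it to \<open>Suc j\<close>; the inductions on length therefore generalise over
    it.\<close>
  define p where "p = (\<lambda>j k. foldr reflect (map \<nu> [j..<j + k]) 0)"
  have p_Suc: "p j (Suc k) = reflect (\<nu> j) (p (Suc j) k)" for j k
  proof -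
    have "[j..<j + Suc k] = j # [Suc j..<Suc j + k]"
      using upt_conv_Cons[of j "j + Suc k"] by (simp del: upt_Suc)
    then show ?thesis
      by (simp only: p_def list.map foldr.simps comp_apply)
  qed
  have cmod_p: "cmod (p j k) \<le> 1" for j k
    by (simp add: p_def cmod_word_le_1)
  have away_p: "away (\<nu> j) (p (Suc j) k)" for j k
  proof (induction k arbitrary: j)
    case (Suc k)
    have "p (Suc j) (Suc k) \<in> mirror_disc (\<nu> (Suc j))"
      unfolding p_Suc by (intro reflect_away_in_mirror_disc cmod_p Suc)
    then show ?case
      using adj[of j] by (metis away_mirror_disc)
  qed (simp add: p_def away_0)
  \<comment> \<open>Both points pass through the same reflections, each at least halving distances;
    at length 0 the distance is \<open>cmod (\<zeta> j) = 1\<close>.\<close>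
  have near: "cmod (p j k - \<zeta> j) \<le> (1/2) ^ k" for j k
  proof (induction k arbitrary: j)
    case (Suc k)
    have "cmod (p j (Suc k) - \<zeta> j) = cmod (reflect (\<nu> j) (p (Suc j) k) - reflect (\<nu> j) (\<zeta> (Suc j)))"
      using step(2)[of j] by (simp add: p_Suc)
    also have "\<dots> \<le> (1/2) ^ (\<nu> j * \<nu> j) / 16 * cmod (p (Suc j) k - \<zeta> (Suc j))"
      by (rule reflect_contraction) (simp_all add: cmod_p \<zeta>(3) away_p step(3))
    also have "\<dots> \<le> (1/2) * (1/2) ^ k"
      using Suc[of "Suc j"] power_le_one[of "1/2::real" "\<nu> j * \<nu> j"] by (intro mult_mono) auto
    finally show ?case by simp
  qed (simp add: p_def \<zeta>(3))

  define R where "R = arcosh (1 + 2 * (1 / mirror_radius N + 1)\<^sup>2)"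
  obtain T where T: "\<And>t g. t \<ge> T \<Longrightarrow> g \<in> reflection_group UNIV \<Longrightarrow> R < hdist (g (geo_ray \<xi> t)) 0"
    using \<xi> by (auto simp: nonconical_limit_set_def) metis
  \<comment> \<open>From \<open>near\<close>, \<open>cmod b \<ge> 1 - (1/2) ^ k\<close>. This
    \<open>K\<close> makes the ray point of modulus \<open>cmod b\<close> occur at a time
    \<open>t \<ge> T\<close>.\<close>
  obtain K where K: "(1/2::real) ^ K < 1 - tanh (T / 2)"
    using real_arch_pow_inv[of "1 - tanh (T / 2)" "1/2"] tanh_real_lt_1[of "T / 2"] by auto
  obtain k where k: "K \<le> k" "\<nu> k < N"
    using frequent by blast
  let ?f = "foldr reflect (rev (w k))"
  define b where "b = p 0 k"
  have b_w: "b = foldr reflect (w k) 0"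
    by (simp add: b_def p_def w_def)
  have "b \<in> hdisk"
    unfolding b_w by (rule word_in_hdisk) (simp add: hdisk_def)
  then have b: "cmod b < 1" "?f b = 0"
    by (simp_all add: b_w word_rev_word hdisk_def)
  obtain m where m: "conformal_factor ?f m"
    using conformal_factor_word by blast

  \<comment> \<open>With \<open>r\<close> the radius of mirror \<open>\<nu> k\<close>, the image of
    0 is at least \<open>4 * r\<close> and the image of \<open>\<xi>\<close> at most
    \<open>r / 2\<close> from its center. As \<open>\<nu> k < N\<close>, also
    \<open>r \<ge> mirror_radius N\<close>.\<close>
  have "mirror_radius N \<le> cmod (?f \<xi> - ?f 0)"
  proof -
    let ?c = "mirror_center (\<nu> k)"
    have "mirror_pos (\<nu> k) / 4 \<le> cmod (?f 0 - ?c)"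
      using away_fwd[of k] by (simp add: away_def)
    moreover have "cmod (?f \<xi> - ?c) \<le> mirror_radius (\<nu> k) / 2"
      using \<zeta>(2)[of k] by (simp add: fwd mirror_disc_def dist_norm norm_minus_commute)
    moreover have "mirror_radius N \<le> mirror_radius (\<nu> k)"
      using k by (intro mirror_radius_antimono) simp
    ultimately show ?thesis
      using norm_triangle_ineq[of "?f 0 - ?f \<xi>" "?f \<xi> - ?c"] mirror_radius_le[of "\<nu> k"]
        mirror_radius_pos[of "\<nu> k"] mirror_pos_bounds[of "\<nu> k"] norm_minus_commute[of "?f 0" "?f \<xi>"]
      by simp
  qed
  then have le: "hdist (?f (of_real (cmod b) * \<xi>)) 0 \<le> R"
    unfolding R_def using \<zeta>(3)[of 0] mirror_radius_pos
    by (intro conformal_factor_ray_recurrence[OF m b]) (auto simp: \<zeta>_def)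

  obtain t where t: "tanh (t / 2) = cmod b"
    using tanh_half_surj[of "cmod b"] b by auto
  have "1 - (1/2) ^ k \<le> cmod b"
    using near[of 0 k] \<zeta>(3)[of 0] norm_triangle_ineq2[of "\<zeta> 0" "\<zeta> 0 - b"]
    by (simp add: b_def norm_minus_commute)
  moreover have "(1/2::real) ^ k \<le> (1/2) ^ K"
    using k(1) by (intro power_decreasing) auto
  ultimately have "tanh (T / 2) \<le> tanh (t / 2)"
    using K unfolding t by linarith
  then have "T \<le> t" by simp
  moreover have "on_disk ?f \<in> reflection_group UNIV"
    unfolding reflection_group_def by (intro imageI) auto
  ultimately have "R < hdist (on_disk ?f (geo_ray \<xi> t)) 0"
    by (rule T)
  moreover have "geo_ray \<xi> t \<in> hdisk"
    using b \<zeta>(3)[of 0] by (simp add: geo_ray_def hdisk_def norm_mult t \<zeta>_def)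
  ultimately show False
    using le by (simp add: on_disk_def geo_ray_def t)
qed

section \<open>Limit points coded by large letters, and the dimension estimate\<close>

definition deep_set :: "nat \<Rightarrow> complex set" where
  "deep_set N = {\<xi> \<in> mirror_limit_set. \<forall>k. \<exists>n\<ge>N. (shift ^^ k) \<xi> \<in> mirror_disc n}"

lemma limit_set_subset_sphere: "limit_set G \<subseteq> sphere 0 1"
  by (auto simp: limit_set_def)

lemma shift_deep_set:
  assumes "\<xi> \<in> deep_set N"
  shows "shift \<xi> \<in> deep_set N"
  unfolding deep_set_def
proof (intro CollectI conjI allI)
  show "shift \<xi> \<in> mirror_limit_set"
    using assms by (simp add: deep_set_def shift_limit_set)
  fix k
  have "\<exists>n\<ge>N. (shift ^^ Suc k) \<xi> \<in> mirror_disc n"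
    using assms unfolding deep_set_def by blast
  then show "\<exists>n\<ge>N. (shift ^^ k) (shift \<xi>) \<in> mirror_disc n"
    by (simp add: funpow_swap1)
qed

text \<open>The reflections are the inverse branches of \<open>shift\<close>. Restricting to
  \<open>away\<close> points is what makes the contraction estimate applicable to each
  piece.\<close>

lemma deep_set_self_cover:
  "deep_set N \<subseteq> (\<Union>i. reflect (N + i) ` {\<zeta> \<in> deep_set N. away (N + i) \<zeta>})"
proof
  fix \<xi> assume \<xi>: "\<xi> \<in> deep_set N"
  then have "\<exists>n\<ge>N. (shift ^^ 0) \<xi> \<in> mirror_disc n"
    unfolding deep_set_def by blast
  then obtain n where n: "N \<le> n" "\<xi> \<in> mirror_disc n"
    by auto
  have "\<xi> \<in> mirror_limit_set"
    using \<xi> by (simp add: deep_set_def)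
  from limit_set_eq_reflect_shift[OF this n(2)] shift_deep_set[OF \<xi>]
  have "\<xi> \<in> reflect (N + (n - N)) ` {\<zeta> \<in> deep_set N. away (N + (n - N)) \<zeta>}"
    using n(1) by auto
  then show "\<xi> \<in> (\<Union>i. reflect (N + i) ` {\<zeta> \<in> deep_set N. away (N + i) \<zeta>})"
    by blast
qed

lemma hausdorff_content_deep_set:
  assumes s: "0 < s" and N: "2 \<le> N" "1 \<le> N * s"
  shows "hausdorff_content s (deep_set N) = 0"
proof -
  let ?h = "hausdorff_content s (deep_set N)"
  have sub: "deep_set N \<subseteq> sphere 0 1"
    using limit_set_subset_sphere by (auto simp: deep_set_def)
  \<comment> \<open>From \<open>N * s \<ge> 1\<close> and \<open>N \<ge> 2\<close> follows
    \<open>(N + i)^2 * s \<ge> N + i \<ge> i + 2\<close>, so the weights sum to at most 1/2.\<close>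
  have weight: "((1/2) ^ ((N + i) * (N + i))) powr s \<le> (1/2) * (1/2) ^ Suc i" for i
  proof -
    have "real N * s \<le> real (N + i) * s"
      using s by (intro mult_right_mono) auto
    then have "real (N + i) * 1 \<le> real (N + i) * (real (N + i) * s)"
      using N(2) by (intro mult_left_mono) auto
    moreover have "real (i + 2) \<le> real (N + i) * 1"
      using N(1) by simp
    ultimately have *: "real (i + 2) \<le> real ((N + i) * (N + i)) * s"
      unfolding of_nat_mult mult.assoc by linarith
    have "((1/2::real) ^ ((N + i) * (N + i))) powr s = (1/2) powr (real ((N + i) * (N + i)) * s)"
      by (simp only: powr_powr[symmetric] powr_realpow[of "1/2"] zero_less_divide_1_iff zero_less_numeral)
    also have "\<dots> \<le> (1/2) powr (real (i + 2))"
      using * by (intro powr_mono') auto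
    also have "\<dots> = (1/2) ^ (i + 2)"
      by (rule powr_realpow) simp
    finally show ?thesis by simp
  qed
  have "?h \<le> hausdorff_content s (\<Union>i. reflect (N + i) ` {\<zeta> \<in> deep_set N. away (N + i) \<zeta>})"
    by (rule hausdorff_content_mono[OF deep_set_self_cover])
  also have "\<dots> \<le> (\<Sum>i. hausdorff_content s (reflect (N + i) ` {\<zeta> \<in> deep_set N. away (N + i) \<zeta>}))"
    by (rule hausdorff_content_countable_subadditive)
  also have "\<dots> \<le> (\<Sum>i. ennreal ((1/2) * (1/2) ^ Suc i) * ?h)"
  proof (intro suminf_le)
    fix i
    have "hausdorff_content s (reflect (N + i) ` {\<zeta> \<in> deep_set N. away (N + i) \<zeta>})
        \<le> ennreal (((1/2) ^ ((N + i) * (N + i))) powr s)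
          * hausdorff_content s {\<zeta> \<in> deep_set N. away (N + i) \<zeta>}"
      using sub s by (intro hausdorff_content_reflect_le) auto
    also have "\<dots> \<le> ennreal ((1/2) * (1/2) ^ Suc i) * ?h"
      using weight by (intro mult_mono ennreal_leI hausdorff_content_mono) auto
    finally show "hausdorff_content s (reflect (N + i) ` {\<zeta> \<in> deep_set N. away (N + i) \<zeta>})
        \<le> ennreal ((1/2) * (1/2) ^ Suc i) * ?h" .
  qed auto
  also have "\<dots> = (\<Sum>i. ennreal ((1/2) * (1/2) ^ Suc i)) * ?h"
    by simp
  also have "(\<Sum>i. ennreal ((1/2) * (1/2) ^ Suc i)) = ennreal (1/2)"
    using sums_mult[OF power_half_series, of "1/2"]
    by (intro suminf_ennreal_eq) (simp_all only: mult_1_right, auto)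
  finally have half: "?h \<le> ennreal (1/2) * ?h" .
  \<comment> \<open>Finiteness is essential, since top also satisfies \<open>half\<close>.\<close>
  have "?h \<le> ennreal (ang_diam (deep_set N) powr s)"
    by (rule hausdorff_content_le_ang_diam[OF sub])
  then have "?h < top"
    by (rule le_less_trans) simp
  then obtain x where x: "0 \<le> x" "?h = ennreal x"
    by (cases ?h) auto
  have "ennreal x \<le> ennreal (1/2 * x)"
    using half x(1) unfolding x(2) by (subst ennreal_mult) auto
  then have "x \<le> 1/2 * x"
    using x(1) by (subst (asm) ennreal_le_iff) auto
  with x show ?thesis by simp
qed

text \<open>Apart from the point 1, one more preimage under \<open>shift\<close> is covered by
  countably many reflected, hence contracted, copies of the previous null set.\<close>

lemma hausdorff_content_preimage_shift:
  assumes E: "hausdorff_content s E = 0" and s: "0 < s"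
  shows "hausdorff_content s {\<xi> \<in> mirror_limit_set. (shift ^^ j) \<xi> \<in> E} = 0"
proof (induction j)
  case 0
  have "{\<xi> \<in> mirror_limit_set. (shift ^^ 0) \<xi> \<in> E} \<subseteq> E"
    by auto
  from hausdorff_content_mono[OF this, of s] show ?case
    using E by simp
next
  case (Suc j)
  define P where "P = {\<xi> \<in> mirror_limit_set. (shift ^^ j) \<xi> \<in> E}"
  have "hausdorff_content s (reflect n ` {\<zeta> \<in> P. away n \<zeta>}) = 0" for n
  proof -
    have "hausdorff_content s {\<zeta> \<in> P. away n \<zeta>} \<le> hausdorff_content s P"
      by (rule hausdorff_content_mono) auto
    then have zero: "hausdorff_content s {\<zeta> \<in> P. away n \<zeta>} = 0"
      using Suc unfolding P_def by simp
    have "P \<subseteq> sphere 0 1"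
      using limit_set_subset_sphere by (auto simp: P_def)
    then have "hausdorff_content s (reflect n ` {\<zeta> \<in> P. away n \<zeta>})
        \<le> ennreal (((1/2) ^ (n * n)) powr s) * hausdorff_content s {\<zeta> \<in> P. away n \<zeta>}"
      using s by (intro hausdorff_content_reflect_le) auto
    then show ?thesis
      unfolding zero by simp
  qed
  then have "hausdorff_content s ({1} \<union> (\<Union>n. reflect n ` {\<zeta> \<in> P. away n \<zeta>})) = 0"
    by (intro hausdorff_content_Un_zero hausdorff_content_UN_zero hausdorff_content_singleton) auto
  moreover have cover: "{\<xi> \<in> mirror_limit_set. (shift ^^ Suc j) \<xi> \<in> E}
      \<subseteq> {1} \<union> (\<Union>n. reflect n ` {\<zeta> \<in> P. away n \<zeta>})"
  proof clarify
    fix \<xi> assume \<xi>: "\<xi> \<in> mirror_limit_set" "(shift ^^ Suc j) \<xi> \<in> E"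
      "\<xi> \<notin> (\<Union>n. reflect n ` {\<zeta> \<in> P. away n \<zeta>})"
    show "\<xi> = 1"
    proof (rule ccontr)
      assume "\<xi> \<noteq> 1"
      with \<xi>(1) obtain n where n: "\<xi> \<in> mirror_disc n"
        by (rule limit_set_cases)
      have "shift \<xi> \<in> P"
        using \<xi> by (simp add: P_def shift_limit_set funpow_swap1)
      with limit_set_eq_reflect_shift[OF \<xi>(1) n] \<xi>(3) show False
        by blast
    qed
  qed
  ultimately show ?case
    using hausdorff_content_mono[OF cover, of s] by (simp only: le_zero_eq)
qed

text \<open>An itinerary that reaches 1 has no infinite code and is caught by the added point 1;
  every other one eventually uses only letters \<open>\<ge> N\<close>. Here \<open>N\<close> is
  arbitrary, so it may be chosen depending on \<open>s\<close>.\<close>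

lemma nonconical_subset:
  "nonconical_limit_set (reflection_group UNIV)
    \<subseteq> (\<Union>j. {\<xi> \<in> mirror_limit_set. (shift ^^ j) \<xi> \<in> deep_set N \<union> {1}})"
proof
  fix \<xi> assume \<xi>: "\<xi> \<in> nonconical_limit_set (reflection_group UNIV)"
  then have L: "\<xi> \<in> mirror_limit_set"
    by (simp add: nonconical_limit_set_def)
  have "\<exists>j. (shift ^^ j) \<xi> \<in> deep_set N \<union> {1}"
  proof (cases "\<exists>j. (shift ^^ j) \<xi> = 1")
    case False
    then have "\<exists>n. (shift ^^ k) \<xi> \<in> mirror_disc n" for k
      using limit_set_cases[OF funpow_shift_limit_set[OF L]] by metis
    then obtain \<nu> where \<nu>: "\<And>k. (shift ^^ k) \<xi> \<in> mirror_disc (\<nu> k)"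
      by metis
    from nonconical_itinerary[OF \<xi> this] obtain j where j: "\<And>k. j \<le> k \<Longrightarrow> N \<le> \<nu> k"
      by blast
    have "\<exists>n\<ge>N. (shift ^^ k) ((shift ^^ j) \<xi>) \<in> mirror_disc n" for k
      using \<nu>[of "k + j"] j[of "k + j"] by (auto simp: funpow_add)
    then have "(shift ^^ j) \<xi> \<in> deep_set N"
      using funpow_shift_limit_set[OF L] by (simp add: deep_set_def)
    then show ?thesis by blast
  qed auto
  with L show "\<xi> \<in> (\<Union>j. {\<xi> \<in> mirror_limit_set. (shift ^^ j) \<xi> \<in> deep_set N \<union> {1}})"
    by blast
qed

lemma hausdorff_dim_nonconical: "hausdorff_dim (nonconical_limit_set (reflection_group UNIV)) = 0"
proof (rule hausdorff_dim_zero_if_content_zero)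
  fix s :: real assume s: "0 < s"
  define N where "N = max 2 (nat \<lceil>1 / s\<rceil>)"
  have "1 / s \<le> real N"
    unfolding N_def by linarith
  then have N: "2 \<le> N" "1 \<le> N * s"
    using s by (auto simp: N_def field_simps)
  have "hausdorff_content s (deep_set N \<union> {1}) = 0"
    by (intro hausdorff_content_Un_zero hausdorff_content_deep_set hausdorff_content_singleton s N) simp
  then have "hausdorff_content s (\<Union>j. {\<xi> \<in> mirror_limit_set. (shift ^^ j) \<xi> \<in> deep_set N \<union> {1}}) = 0"
    by (intro hausdorff_content_UN_zero hausdorff_content_preimage_shift s)
  then show "hausdorff_content s (nonconical_limit_set (reflection_group UNIV)) = 0"
    using hausdorff_content_mono[OF nonconical_subset[of N], of s] by simp
qed

theorem theorem1p4:
  shows "\<exists>G. discrete_isom_subgroup G \<and> \<not> finitely_generated G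
           \<and> hausdorff_dim (nonconical_limit_set G) = 0"
  using discrete_reflection_group not_finitely_generated_reflection_group hausdorff_dim_nonconical
  by blast

end
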